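(* Fix a real number $\varepsilon>0$. Then for all sufficiently large integers $k$ (depending on $\varepsilon$) the following holds: for all integers $\ell$ with $1\leq \ell\leq k/\log^4 k$, \[\operatorname{ind}(k,\ell)\leq 90\cdot \ell^{-1/4},\] and for all integers $\ell$ with $k/\log^4 k\leq \ell\leq (1-\varepsilon)k/2$, \[\operatorname{ind}(k,\ell)\leq 90\cdot k^{-1/4}\cdot \log k.\]
   Context: All logarithms are to base 2. For integers $n\geq k\geq 1$ and $0\leq \ell\leq \binom{k}{2}$, let $I(n,k,\ell)$ be the maximum, over all (simple) graphs $G$ on $n$ vertices, of the probability that a uniformly random $k$-vertex subset of $V(G)$ spans exactly $\ell$ edges of $G$. $I(n,k,\ell)$ is non-increasing in $n$, and $\operatorname{ind}(k,\ell)=\lim_{n\to\infty}I(n,k,\ell)$. *)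

theory Defs
  imports "HOL-Probability.Probability"
begin

definition ksubsets :: "'a set \<Rightarrow> nat \<Rightarrow> 'a set set" where
  "ksubsets V k = {S. S \<subseteq> V \<and> finite S \<and> card S = k}"

text \<open>A simple graph on a vertex set \<open>V\<close> is identified with its edge set.\<close>

definition graphs_on :: "'a set \<Rightarrow> 'a set set set" where
  "graphs_on V = Pow (ksubsets V 2)"

definition edges_spanned :: "'a set set \<Rightarrow> 'a set \<Rightarrow> nat" where
  "edges_spanned E S = card (E \<inter> ksubsets S 2)"

text \<open>Meaningful for \<open>k \<le> n\<close> only: otherwise there are no \<open>k\<close>-element subsets to sample.\<close>

definition max_ind :: "nat \<Rightarrow> nat \<Rightarrow> nat \<Rightarrow> real" where
  "max_ind n k l =
     Max ((\<lambda>E. measure_pmf.prob (pmf_of_set (ksubsets {..<n} k)) {S. edges_spanned E S = l})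
          ` graphs_on {..<n})"

definition ind :: "nat \<Rightarrow> nat \<Rightarrow> real" where
  "ind k l = lim (\<lambda>n. max_ind n k l)"

text \<open>The limit in \<^const>\<open>ind\<close> exists, since \<^const>\<open>max_ind\<close> is non-increasing in \<open>n \<ge> k\<close>.\<close>

lemma finite_ksubsets: "finite V \<Longrightarrow> finite (ksubsets V k)"
  by (simp add: ksubsets_def)

lemma card_ksubsets: "finite V \<Longrightarrow> card (ksubsets V k) = card V choose k"
  using n_subsets[of V k] unfolding ksubsets_def
  by (metis (no_types, lifting) Collect_cong finite_subset)

lemma prob_eq:
  assumes "k \<le> n"
  shows "measure_pmf.prob (pmf_of_set (ksubsets {..<n} k)) {S. edges_spanned E S = l} =
         card {S \<in> ksubsets {..<n} k. edges_spanned E S = l} / (n choose k)"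
proof -
  have c: "card (ksubsets {..<n} k) = n choose k" using card_ksubsets[of "{..<n}" k] by simp
  hence "ksubsets {..<n} k \<noteq> {}" using assms by (metis binomial_eq_0_iff card.empty not_less)
  moreover have "finite (ksubsets {..<n} k)" by (simp add: finite_ksubsets)
  ultimately show ?thesis
    by (simp add: measure_pmf_of_set c Int_def)
qed

lemma finite_graphs_on: "finite V \<Longrightarrow> finite (graphs_on V)"
  by (simp add: graphs_on_def finite_ksubsets)

lemma max_ind_nonneg: "0 \<le> max_ind n k l"
proof -
  have "{} \<in> graphs_on {..<n}" by (simp add: graphs_on_def)
  then have "measure_pmf.prob (pmf_of_set (ksubsets {..<n} k)) {S. edges_spanned {} S = l} \<le> max_ind n k l"
    unfolding max_ind_def by (intro Max_ge finite_imageI finite_graphs_on imageI) auto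
  then show ?thesis by (meson measure_nonneg order_trans)
qed

lemma card_le_max_ind:
  fixes V :: "'a set"
  assumes V: "finite V" "card V = n" and E: "E \<in> graphs_on V" and k: "k \<le> n"
  shows "card {S \<in> ksubsets V k. edges_spanned E S = l} \<le> max_ind n k l * (n choose k)"
proof -
  obtain f where f: "bij_betw f V {..<n}"
    using ex_bij_betw_finite_nat[OF V(1)] V(2) by (auto simp: atLeast0LessThan)
  have inj: "inj_on f V" and im: "f ` V = {..<n}" using f by (auto simp: bij_betw_def)
  define F where "F = (`) f ` E"
  have EV: "E \<subseteq> ksubsets V 2" using E by (simp add: graphs_on_def)
  have card_im: "card (f ` S) = card S" if "S \<subseteq> V" for S
    using card_image inj inj_on_subset that by blast
  have F: "F \<in> graphs_on {..<n}"
    proof -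
    have "f ` e \<in> ksubsets {..<n} 2" if "e \<in> E" for e
    proof -
      have "e \<subseteq> V" "finite e" "card e = 2" using that EV by (auto simp: ksubsets_def)
      thus ?thesis using card_im[of e] im by (auto simp: ksubsets_def)
    qed
    thus ?thesis by (auto simp: F_def graphs_on_def)
  qed
  have injP: "inj_on ((`) f) (Pow V)" using inj by (simp add: inj_on_image_Pow)
  have span: "edges_spanned F (f ` S) = edges_spanned E S" if S: "S \<subseteq> V" for S
  proof -
    have "F \<inter> ksubsets (f ` S) 2 = (`) f ` (E \<inter> ksubsets S 2)"
    proof (intro equalityI subsetI)
      fix x assume x: "x \<in> F \<inter> ksubsets (f ` S) 2"
      then obtain e where e: "e \<in> E" "x = f ` e" by (auto simp: F_def)
      have eV: "e \<subseteq> V" "finite e" "card e = 2" using e EV by (auto simp: ksubsets_def)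
      have "f ` e \<subseteq> f ` S" using x e by (auto simp: ksubsets_def)
      hence "e \<subseteq> S" using inj eV S by (simp add: inj_on_image_subset_iff)
      thus "x \<in> (`) f ` (E \<inter> ksubsets S 2)" using e eV by (auto simp: ksubsets_def)
    next
      fix x assume "x \<in> (`) f ` (E \<inter> ksubsets S 2)"
      then obtain e where e: "e \<in> E" "e \<in> ksubsets S 2" "x = f ` e" by auto
      thus "x \<in> F \<inter> ksubsets (f ` S) 2" using S card_im[of e] by (auto simp: F_def ksubsets_def)
    qed
    moreover have "inj_on ((`) f) (E \<inter> ksubsets S 2)"
      by (rule inj_on_subset[OF injP]) (use EV in \<open>auto simp: ksubsets_def\<close>)
    ultimately show ?thesis by (simp add: edges_spanned_def card_image)
  qed
  have "card {S \<in> ksubsets V k. edges_spanned E S = l} \<le> card {S \<in> ksubsets {..<n} k. edges_spanned F S = l}"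
  proof (rule card_inj_on_le[where f = "(`) f"])
    show "inj_on ((`) f) {S \<in> ksubsets V k. edges_spanned E S = l}"
      by (rule inj_on_subset[OF injP]) (auto simp: ksubsets_def)
    show "(`) f ` {S \<in> ksubsets V k. edges_spanned E S = l} \<subseteq> {S \<in> ksubsets {..<n} k. edges_spanned F S = l}"
    proof safe
      fix S assume S: "S \<in> ksubsets V k"
      hence SV: "S \<subseteq> V" "finite S" "card S = k" by (auto simp: ksubsets_def)
      show "f ` S \<in> ksubsets {..<n} k" using SV im card_im[of S] by (auto simp: ksubsets_def)
      show "edges_spanned F (f ` S) = edges_spanned E S" using span SV by simp
    qed
    show "finite {S \<in> ksubsets {..<n} k. edges_spanned F S = l}" by (simp add: finite_ksubsets)
  qed
  hence "real (card {S \<in> ksubsets V k. edges_spanned E S = l}) / (n choose k) \<le>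
      card {S \<in> ksubsets {..<n} k. edges_spanned F S = l} / (n choose k)"
    by (intro divide_right_mono) auto
  also have "\<dots> \<le> max_ind n k l"
    unfolding max_ind_def prob_eq[OF k, symmetric]
    by (intro Max_ge finite_imageI finite_graphs_on imageI F) auto
  finally have "real (card {S \<in> ksubsets V k. edges_spanned E S = l}) / (n choose k) \<le> max_ind n k l" .
  moreover have "real (n choose k) > 0" using k by simp
  ultimately show ?thesis by (simp only: pos_divide_le_eq)
qed

lemma max_ind_Suc_le:
  assumes k: "k \<le> n"
  shows "max_ind (Suc n) k l \<le> max_ind n k l"
proof -
  let ?V = "{..<Suc n}"
  have bnd: "measure_pmf.prob (pmf_of_set (ksubsets ?V k)) {S. edges_spanned E S = l} \<le> max_ind n k l"
    if E: "E \<in> graphs_on ?V" for E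
  proof -
    define A where "A = {S \<in> ksubsets ?V k. edges_spanned E S = l}"
    have finA: "finite A" unfolding A_def by (simp add: finite_ksubsets)
    have "(\<Sum>S\<in>A. card {v \<in> ?V. v \<notin> S}) = (\<Sum>v\<in>?V. card {S \<in> A. v \<notin> S})"
      using sum_multicount_gen[OF finA, of ?V "\<lambda>S v. v \<notin> S" "\<lambda>v. card {S \<in> A. v \<notin> S}"] by simp
    moreover have "card {v \<in> ?V. v \<notin> S} = Suc n - k" if "S \<in> A" for S
    proof -
      have "S \<subseteq> ?V" "finite S" "card S = k" using that by (auto simp: A_def ksubsets_def)
      moreover have "{v \<in> ?V. v \<notin> S} = ?V - S" by auto
      ultimately show ?thesis by (simp add: card_Diff_subset)
    qed
    ultimately have eq: "card A * (Suc n - k) = (\<Sum>v\<in>?V. card {S \<in> A. v \<notin> S})" by simp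
    have le: "card {S \<in> A. v \<notin> S} \<le> max_ind n k l * (n choose k)" if v: "v \<in> ?V" for v
    proof -
      define W where "W = ?V - {v}"
      define E' where "E' = E \<inter> ksubsets W 2"
      have "{S \<in> A. v \<notin> S} = {S \<in> ksubsets W k. edges_spanned E' S = l}"
      proof -
        have a: "edges_spanned E' S = edges_spanned E S" if "S \<subseteq> W" for S
        proof -
          have "E' \<inter> ksubsets S 2 = E \<inter> ksubsets S 2" using that by (auto simp: E'_def ksubsets_def)
          thus ?thesis by (simp add: edges_spanned_def)
        qed
        have b: "S \<in> ksubsets ?V k \<and> v \<notin> S \<longleftrightarrow> S \<in> ksubsets W k" for S
          unfolding W_def ksubsets_def by blast
        have c: "S \<subseteq> W" if "S \<in> ksubsets W k" for S using that by (simp add: ksubsets_def)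
        have "S \<in> {S \<in> A. v \<notin> S} \<longleftrightarrow> S \<in> {S \<in> ksubsets W k. edges_spanned E' S = l}" for S
          unfolding A_def mem_Collect_eq using a[of S] b[of S] c[of S] by metis
        thus ?thesis by (rule set_eqI)
      qed
      moreover have "card W = n" "finite W" using v by (simp_all add: W_def)
      moreover have "E' \<in> graphs_on W" by (simp add: E'_def graphs_on_def)
      ultimately show ?thesis using card_le_max_ind[of W n E' k l] k by simp
    qed
    have "real (card A) * real (Suc n - k) = (\<Sum>v\<in>?V. real (card {S \<in> A. v \<notin> S}))"
      using arg_cong[OF eq, of real] by (simp only: of_nat_mult of_nat_sum)
    also have "\<dots> \<le> (\<Sum>v\<in>?V. max_ind n k l * (n choose k))" by (intro sum_mono le)
    also have "\<dots> = max_ind n k l * real (Suc n * (n choose k))" by (simp add: algebra_simps)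
    also have "Suc n * (n choose k) = (Suc n - k) * (Suc n choose k)"
      using binomial_absorb_comp[of "Suc n" k] k by simp
    finally have "real (card A) * real (Suc n - k) \<le>
        (max_ind n k l * real (Suc n choose k)) * real (Suc n - k)"
      by (simp only: of_nat_mult ac_simps)
    hence "real (card A) \<le> max_ind n k l * real (Suc n choose k)"
      by (rule mult_right_le_imp_le) (use k in simp)
    moreover have "real (Suc n choose k) > 0" using k by simp
    ultimately have "real (card A) / (Suc n choose k) \<le> max_ind n k l" by (simp only: pos_divide_le_eq)
    thus ?thesis unfolding A_def by (simp only: prob_eq[OF le_SucI[OF k]])
  qed
  have "{} \<in> graphs_on ?V" by (simp add: graphs_on_def)
  thus ?thesis unfolding max_ind_def[of "Suc n"]
    by (intro Max.boundedI finite_imageI finite_graphs_on) (auto intro: bnd)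
qed

lemma max_ind_tendsto_ind: "(\<lambda>n. max_ind n k l) \<longlonglongrightarrow> ind k l"
proof -
  have "decseq (\<lambda>n. max_ind (n + k) k l)"
    by (intro decseq_SucI) (simp add: max_ind_Suc_le)
  hence "convergent (\<lambda>n. max_ind (n + k) k l)"
    by (rule decseq_convergent[where B = 0]) (auto intro: convergentI max_ind_nonneg)
  hence "convergent (\<lambda>n. max_ind n k l)"
    using convergent_ignore_initial_segment[of "\<lambda>n. max_ind n k l" k] by simp
  thus ?thesis unfolding ind_def by (simp add: convergent_LIMSEQ_iff)
qed

end

theory Submission
  imports Defs "HOL-Real_Asymp.Real_Asymp"
begin

text \<open>
  As \<open>n \<rightarrow> \<infinity>\<close> the random \<open>k\<close>-set may be replaced by a random sequence of \<open>k\<close> independent vertices.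
  If it spans \<open>l\<close> edges, then its number \<open>m\<close> of non-isolated positions satisfies
  \<open>\<surd>(2l) \<le> m \<le> 2l \<le> (1 - \<epsilon>)k\<close>.

  Reveal the first \<open>k - x\<close> vertices; they split the vertex set into the vertices touching them
  and the remaining ones. Among the last \<open>x\<close> vertices the number \<open>q\<close> of touching ones is binomial, and
  given \<open>q\<close> they are the first \<open>q\<close> terms of a random sequence of touching vertices and the first
  \<open>x - q\<close> terms of a random sequence of non-touching ones. A further touching vertex strictly increases
  the number of edges. So if the last \<open>T\<close> non-touching vertices are isolated, then none of the next \<open>T\<close> values of \<open>q\<close>
  gives exactly \<open>l\<close> edges: the good values of \<open>q\<close> are \<open>T\<close>-separated, and their total
  binomial weight is at most twice the largest single weight, \<open>O(q\<^sup>-\<^sup>1\<^sup>/\<^sup>2)\<close>, plus \<open>1/T\<close>.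

  By symmetry the sequence may be permuted at random. A vertex that is non-isolated but does not touch the
  first \<open>k - x\<close> vertices needs all its neighbours among the last \<open>x\<close> positions, which is rare; hence a
  random arrangement has \<open>q \<ge> xm/(4k)\<close> and its last \<open>T\<close> non-touching vertices isolated with probability
  at least \<open>1/2\<close>. The choice \<open>x = k/16\<close>, \<open>T \<approx> k\<^sup>1\<^sup>/\<^sup>4\<close> handles \<open>m \<le> k\<^sup>3\<^sup>/\<^sup>4\<close> and gives \<open>O(l\<^sup>-\<^sup>1\<^sup>/\<^sup>4)\<close>; the choice
  \<open>x = k\<^sup>3\<^sup>/\<^sup>4\<close> handles \<open>m \<ge> k\<^sup>3\<^sup>/\<^sup>4\<close> and gives \<open>O(k\<^sup>-\<^sup>1\<^sup>/\<^sup>4)\<close>.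
\<close>

section \<open>Sums of binomial weights over separated sets\<close>

text \<open>The midpoint rule underestimates the integral of \<open>1/t\<close> over
  \<open>[n, n+1]\<close>, so \<open>(n + 1/2) (ln (n+1) - ln n)\<close> is at least 1. This is the
  decrease of Stirling's sequence.\<close>

lemma ln_fact_upper_step:
  assumes "1 \<le> n"
  shows "ln (fact (Suc n)) + Suc n - (Suc n + 1/2) * ln (Suc n) \<le> ln (fact n) + n - (n + 1/2) * ln (real n)"
proof -
  have "2 * 1 / (2 * real n + 1) \<le> ln (real n + 1) - ln (real n)"
    using ln_inverse_approx_ge[of "real n" "real n + 1"] assms by (simp add: field_simps)
  hence "1 \<le> (real n + 1/2) * (ln (real n + 1) - ln (real n))"
    by (simp add: field_simps)
  moreover have "ln (fact (Suc n)) = ln (real n + 1) + ln (fact n)"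
    unfolding fact_Suc by (subst ln_mult_pos) (auto simp: add.commute)
  ultimately show ?thesis by (simp add: algebra_simps)
qed

text \<open>The trapezoidal rule overestimates the same integral, and
  \<open>(2n+1)^2 / (4n(n+1)) = 1 + 1/(4n) - 1/(4(n+1))\<close>. The surplus telescopes, so
  subtracting \<open>1/(4n)\<close> from Stirling's sequence makes it nondecreasing.\<close>

lemma ln_fact_lower_step:
  assumes "1 \<le> n"
  shows "ln (fact n) + n - (n + 1/2) * ln (real n) - 1 / (4 * real n) \<le>
    ln (fact (Suc n)) + Suc n - (Suc n + 1/2) * ln (Suc n) - 1 / (4 * real (Suc n))"
proof -
  have "ln (real n + 1) - ln (real n) \<le> (inverse (real n) + inverse (real n + 1)) / 2"
    using ln_inverse_approx_le[of "real n" 1] assms by simp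
  hence "(real n + 1/2) * (ln (real n + 1) - ln (real n)) \<le>
      (real n + 1/2) * ((inverse (real n) + inverse (real n + 1)) / 2)"
    by (intro mult_left_mono) auto
  also have "\<dots> = 1 + 1 / (4 * real n) - 1 / (4 * real (Suc n))"
    using assms by (simp add: divide_simps) (simp add: algebra_simps)
  finally have "(real n + 1/2) * (ln (real n + 1) - ln (real n)) \<le> 1 + 1 / (4 * real n) - 1 / (4 * real (Suc n))" .
  moreover have "ln (fact (Suc n)) = ln (real n + 1) + ln (fact n)"
    unfolding fact_Suc by (subst ln_mult_pos) (auto simp: add.commute)
  ultimately show ?thesis by (simp add: algebra_simps)
qed

lemma ln_fact_ge:
  assumes "1 \<le> n"
  shows "(n + 1/2) * ln (real n) - n \<le> ln (fact n)"
proof -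
  \<comment> \<open>At \<open>n = 1\<close> the monotone quantity equals
    \<open>1 - 1/4\<close>.\<close>
  have "3/4 \<le> ln (fact n) + n - (n + 1/2) * ln (real n) - 1 / (4 * real n)"
    using assms
  proof (induction n rule: nat_induct_at_least)
    case (Suc n)
    thus ?case using ln_fact_lower_step[of n] by linarith
  qed simp
  moreover have "0 \<le> 1 / (4 * real n)" by simp
  ultimately show ?thesis by linarith
qed

lemma ln_fact_antimono:
  assumes "1 \<le> m" "m \<le> n"
  shows "ln (fact n) + n - (n + 1/2) * ln (real n) \<le> ln (fact m) + m - (m + 1/2) * ln (real m)"
  using assms(2)
proof (induction n rule: dec_induct)
  case (step n)
  thus ?case using ln_fact_upper_step[of n] assms(1) by linarith
qed simp

text \<open>The Stirling constants of \<open>x!\<close> and \<open>(x - q)!\<close> are compared by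
  monotonicity, and the one of \<open>q!\<close> is only bounded below by 0. Apart from the square
  root, what remains is a relative entropy term, nonpositive by the Gibbs inequality.\<close>

lemma binomial_weight_le:
  fixes a c :: real
  assumes q: "0 < q" "q < x" and a: "0 < a" and c: "0 < c"
  shows "(x choose q) * a ^ q * c ^ (x - q) \<le> sqrt (x / (q * (x - q))) * (a + c) ^ x"
proof -
  define r where "r = x - q"
  have r: "0 < r" "real r = real x - real q" "x = q + r" using q by (auto simp: r_def)
  define p where "p = a / (a + c)"
  define p' where "p' = c / (a + c)"
  have p: "0 < p" "0 < p'" "p + p' = 1" using a c by (auto simp: p_def p'_def simp flip: add_divide_distrib)
  have lnC: "ln (x choose q) = ln (fact x) - ln (fact q) - ln (fact r)"
    using q by (simp add: binomial_fact r_def ln_div ln_mult)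
  have 1: "ln (fact x) + x - (x + 1/2) * ln (real x) \<le> ln (fact r) + r - (r + 1/2) * ln (real r)"
    by (rule ln_fact_antimono) (use r in auto)
  have 2: "(q + 1/2) * ln (real q) - q \<le> ln (fact q)" by (rule ln_fact_ge) (use q in auto)
  \<comment> \<open>The right-hand sides of \<open>3\<close> and \<open>4\<close> add up to
    \<open>(p + p') x - q - r = 0\<close>.\<close>
  have 3: "q * ln (p * x / q) \<le> p * x - q"
  proof -
    have "ln (p * x / q) \<le> p * x / q - 1" by (rule ln_le_minus_one) (use p q in auto)
    hence "q * ln (p * x / q) \<le> q * (p * x / q - 1)" by (intro mult_left_mono) auto
    thus ?thesis using q by (simp add: algebra_simps)
  qed
  have 4: "r * ln (p' * x / r) \<le> p' * x - r"
  proof -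
    have "ln (p' * x / r) \<le> p' * x / r - 1" by (rule ln_le_minus_one) (use p q r in auto)
    hence "r * ln (p' * x / r) \<le> r * (p' * x / r - 1)" by (intro mult_left_mono) auto
    thus ?thesis using r(1) by (simp add: algebra_simps)
  qed
  have 5: "p * x + p' * x = x" using p by (metis distrib_right mult_1)
  have l3: "ln (p * x / q) = ln p + ln x - ln q" using p q by (simp add: ln_div ln_mult)
  have l4: "ln (p' * x / r) = ln p' + ln x - ln r" using p q r by (simp add: ln_div ln_mult)
  have e: "real x * ln x = q * ln x + r * ln x" using r(2) by (simp add: left_diff_distrib)
  have "ln ((x choose q) * p ^ q * p' ^ r) = ln (x choose q) + q * ln p + r * ln p'"
    using p q by (simp add: ln_mult ln_realpow)
  also have "\<dots> \<le> (ln x - ln q - ln r) / 2"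
  proof -
    \<comment> \<open>Naming the products leaves a purely linear inequality.\<close>
    define u1 where "u1 = real q * ln p"
    define u2 where "u2 = real r * ln p'"
    define u3 where "u3 = real q * ln x"
    define u4 where "u4 = real r * ln x"
    define u5 where "u5 = real q * ln q"
    define u6 where "u6 = real r * ln r"
    define u7 where "u7 = real x * ln x"
    define u8 where "u8 = p * x"
    define u9 where "u9 = p' * x"
    show ?thesis using 1 2 3 4 5 r(2) e unfolding lnC l3 l4 ring_distribs
      unfolding u1_def[symmetric] u2_def[symmetric] u3_def[symmetric] u4_def[symmetric] u5_def[symmetric]
        u6_def[symmetric] u7_def[symmetric] u8_def[symmetric] u9_def[symmetric] by argo
  qed
  also have "\<dots> = ln (sqrt (x / (q * r)))"
    using q r by (simp add: ln_sqrt ln_div ln_mult)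
  finally have *: "(x choose q) * p ^ q * p' ^ r \<le> sqrt (x / (q * r))"
    using p q r(1) by (subst (asm) ln_le_cancel_iff) auto
  have "(x choose q) * a ^ q * c ^ r = (x choose q) * p ^ q * p' ^ r * (a + c) ^ x"
    using a c by (simp add: p_def p'_def power_divide r(3) power_add)
  also have "\<dots> \<le> sqrt (x / (q * r)) * (a + c) ^ x"
    by (intro mult_right_mono *) (use a c in auto)
  finally show ?thesis using q by (simp add: r_def of_nat_diff)
qed

section \<open>Separated sums of monotone and unimodal weights\<close>

text \<open>Every element \<open>b\<close> of \<open>D\<close> except the least pays for
  \<open>t * f b\<close> with the \<open>t\<close> integers ending at \<open>b\<close>, on which
  \<open>f\<close> is at least \<open>f b\<close>. Separation makes these windows disjoint. The
  least element may lack such a window and is charged to \<open>\<beta>\<close>.\<close>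

lemma sum_separated_antimono:
  fixes f :: "nat \<Rightarrow> real" and t :: nat and \<beta> :: real
  assumes fin: "finite D" and t: "1 \<le> t"
    and sub: "D \<subseteq> {s..<N}" and sep: "\<And>p q. p \<in> D \<Longrightarrow> q \<in> D \<Longrightarrow> p < q \<Longrightarrow> p + t \<le> q"
    and nonneg: "\<And>j. 0 \<le> f j" and mono: "\<And>i j. s \<le> i \<Longrightarrow> i \<le> j \<Longrightarrow> f j \<le> f i"
    and \<beta>: "0 \<le> \<beta>" "\<And>q. q \<in> D \<Longrightarrow> f q \<le> \<beta>"
  shows "t * sum f D \<le> t * \<beta> + sum f {s..<N}"
  using fin sub sep \<beta>(2)
proof (induction D arbitrary: N rule: finite_linorder_max_induct)
  case empty
  thus ?case using \<beta>(1) nonneg by (simp add: sum_nonneg)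
next
  case (insert b D)
  have bD: "b \<notin> D" using insert by auto
  show ?case
  proof (cases "D = {}")
    case True
    have "t * f b \<le> t * \<beta>" by (intro mult_left_mono insert.prems) auto
    moreover have "0 \<le> sum f {s..<N}" using nonneg by (simp add: sum_nonneg)
    ultimately show ?thesis using True by simp
  next
    case False
    then obtain d where d: "d \<in> D" by auto
    have sb: "d + t \<le> b" "s \<le> d" using insert.prems(1) insert.prems(2)[of d b] insert.hyps d by auto
    \<comment> \<open>The rest of \<open>D\<close> lies below the window of \<open>b\<close>, so the
      induction hypothesis applies with a smaller \<open>N\<close>.\<close>
    have D: "D \<subseteq> {s..<Suc b - t}"
    proof
      fix p assume p: "p \<in> D"
      hence "p + t \<le> b" using insert.prems(2)[of p b] insert.hyps by auto
      thus "p \<in> {s..<Suc b - t}" using insert.prems(1) p by auto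
    qed
    have IH: "t * sum f D \<le> t * \<beta> + sum f {s..<Suc b - t}"
      by (rule insert.IH) (use D insert.prems in auto)
    have "t * f b = (\<Sum>j\<in>{Suc b - t..<Suc b}. f b)" using sb by simp
    also have "\<dots> \<le> sum f {Suc b - t..<Suc b}"
      by (intro sum_mono mono) (use sb in auto)
    finally have "t * sum f (insert b D) \<le> t * \<beta> + (sum f {s..<Suc b - t} + sum f {Suc b - t..<Suc b})"
      using IH bD insert.hyps by (simp add: algebra_simps)
    also have "sum f {s..<Suc b - t} + sum f {Suc b - t..<Suc b} = sum f {s..<Suc b}"
      by (rule sum.atLeastLessThan_concat) (use sb in auto)
    also have "sum f {s..<Suc b} \<le> sum f {s..<N}"
      by (rule sum_mono2) (use insert.prems(1) nonneg in auto)
    finally show ?thesis by simp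
  qed
qed

text \<open>The reflection \<open>j -> s - j\<close> turns this into the antitone case.\<close>

lemma sum_separated_mono:
  fixes f :: "nat \<Rightarrow> real" and t :: nat and \<beta> :: real
  assumes t: "1 \<le> t"
    and sub: "D \<subseteq> {..s}" and sep: "\<And>p q. p \<in> D \<Longrightarrow> q \<in> D \<Longrightarrow> p < q \<Longrightarrow> p + t \<le> q"
    and nonneg: "\<And>j. 0 \<le> f j" and mono: "\<And>i j. j \<le> s \<Longrightarrow> i \<le> j \<Longrightarrow> f i \<le> f j"
    and \<beta>: "0 \<le> \<beta>" "\<And>q. q \<in> D \<Longrightarrow> f q \<le> \<beta>"
  shows "t * sum f D \<le> t * \<beta> + sum f {..s}"
proof -
  define g where "g = (\<lambda>j. if j \<le> s then f (s - j) else 0)"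
  have inj: "inj_on (\<lambda>q. s - q) {..s}" by (auto simp: inj_on_def)
  have "sum g ((\<lambda>q. s - q) ` D) = (\<Sum>q\<in>D. g (s - q))"
    using inj sub by (subst sum.reindex) (auto intro: inj_on_subset)
  also have "\<dots> = sum f D" by (rule sum.cong) (use sub in \<open>auto simp: g_def\<close>)
  finally have 1: "sum g ((\<lambda>q. s - q) ` D) = sum f D" .
  have "sum g {0..<Suc s} = (\<Sum>j\<in>{..s}. f (s - j))"
    by (rule sum.cong) (auto simp: g_def)
  also have "\<dots> = sum f {..s}"
    by (rule sum.reindex_bij_witness[where i = "\<lambda>j. s - j" and j = "\<lambda>j. s - j"]) auto
  finally have 2: "sum g {0..<Suc s} = sum f {..s}" .
  have "t * sum g ((\<lambda>q. s - q) ` D) \<le> t * \<beta> + sum g {0..<Suc s}"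
  proof (rule sum_separated_antimono[OF _ t])
    show "finite ((\<lambda>q. s - q) ` D)" using sub finite_subset by blast
    fix p q assume "p \<in> (\<lambda>q. s - q) ` D" "q \<in> (\<lambda>q. s - q) ` D" "p < q"
    then obtain p' q' where *: "p' \<in> D" "q' \<in> D" "p = s - p'" "q = s - q'" by auto
    with \<open>p < q\<close> have "q' < p'" by auto
    hence "q' + t \<le> p'" using sep * by auto
    thus "p + t \<le> q" using * sub by auto
  qed (use sub nonneg mono \<beta> in \<open>auto simp: g_def\<close>)
  thus ?thesis by (simp only: 1 2)
qed

text \<open>The weights are unimodal. Each side of the mode costs one \<open>\<beta>\<close>, and
  the windows on both sides together have at most the total weight, which the binomial theorem
  evaluates.\<close>

lemma sum_separated_binomial_weight:
  fixes a c x t :: nat and \<beta> :: real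
  defines "w \<equiv> \<lambda>q. (x choose q) * real a ^ q * real c ^ (x - q)"
  assumes t: "1 \<le> t" and a: "0 < a" and c: "0 < c"
    and sub: "D \<subseteq> {..x}" and sep: "\<And>p q. p \<in> D \<Longrightarrow> q \<in> D \<Longrightarrow> p < q \<Longrightarrow> p + t \<le> q"
    and \<beta>: "0 \<le> \<beta>" "\<And>q. q \<in> D \<Longrightarrow> w q \<le> \<beta>"
  shows "sum w D \<le> 2 * \<beta> + real (a + c) ^ x / t"
proof -
  \<comment> \<open>This is the mode: \<open>w (q+1) / w q = (x - q) a / ((q + 1) c)\<close> is at
    least 1 exactly when \<open>(q + 1)(a + c) \<le> (x + 1) a\<close>. The fact \<open>step\<close>
    is this ratio with denominators cleared.\<close>
  define s where "s = ((x + 1) * a) div (a + c)"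
  have fin: "finite D" using sub finite_subset by blast
  have nonneg: "0 \<le> w q" for q by (simp add: w_def)
  have step: "w (Suc q) * (Suc q * c) = w q * ((x - q) * a)" for q
  proof (cases "q < x")
    case True
    have e: "x - q = Suc (x - Suc q)" using True by simp
    have "(x choose Suc q) * Suc q = (x choose q) * (x - q)"
      using binomial_absorption[of q x] binomial_absorb_comp[of x q]
      by (simp only: mult.commute)
    hence "real (x choose Suc q) * Suc q = (x choose q) * real (x - q)"
      by (metis of_nat_mult)
    note 1 = this
    have 2: "real c ^ (x - q) = c * real c ^ (x - Suc q)" using e by simp
    have "w (Suc q) * (Suc q * c) =
        (real (x choose Suc q) * Suc q) * (real a ^ Suc q * (c * real c ^ (x - Suc q)))"
      by (simp add: w_def) (simp add: algebra_simps)
    also have "\<dots> = ((x choose q) * real (x - q)) * (real a ^ Suc q * real c ^ (x - q))"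
      by (simp only: 1 2)
    also have "\<dots> = w q * ((x - q) * a)" by (simp add: w_def)
    finally show ?thesis .
  qed (auto simp: w_def)
  have up: "w q \<le> w (Suc q)" if "Suc q \<le> s" for q
  proof -
    have "Suc q * (a + c) \<le> s * (a + c)" using that by (rule mult_right_mono) simp
    also have "\<dots> \<le> (x + 1) * a" by (simp add: s_def)
    finally have *: "Suc q * (a + c) \<le> (x + 1) * a" .
    hence "Suc q * a \<le> (x + 1) * a" by (meson le_add1 le_trans mult_le_mono2)
    hence "q \<le> x" using a by simp
    hence "Suc q * c \<le> (x - q) * a" using * by (auto simp: algebra_simps diff_mult_distrib)
    hence "w q * real (Suc q * c) \<le> w q * real ((x - q) * a)"
      by (intro mult_left_mono nonneg) (metis of_nat_le_iff)
    also have "\<dots> = w (Suc q) * real (Suc q * c)" using step[of q] by simp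
    finally show ?thesis using c by (simp del: of_nat_mult of_nat_Suc)
  qed
  have down: "w (Suc q) \<le> w q" if "s \<le> q" for q
  proof (cases "q < x")
    case True
    have "(x + 1) * a < Suc s * (a + c)" unfolding s_def using a
      by (metis add_gr_0 dividend_less_div_times mult_Suc add.commute)
    also have "\<dots> \<le> Suc q * (a + c)" using that by (intro mult_right_mono) auto
    finally have "(x - q) * a \<le> Suc q * c" using True by (auto simp: algebra_simps diff_mult_distrib)
    hence "w q * real ((x - q) * a) \<le> w q * real (Suc q * c)"
      by (intro mult_left_mono nonneg) (metis of_nat_le_iff)
    hence "w (Suc q) * real (Suc q * c) \<le> w q * real (Suc q * c)" using step[of q] by simp
    thus ?thesis using c by (simp del: of_nat_mult of_nat_Suc)
  next
    case False
    hence "w (Suc q) = 0" by (simp add: w_def)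
    thus ?thesis using nonneg by simp
  qed
  have mono: "w i \<le> w j" if "j \<le> s" "i \<le> j" for i j
    using that(2,1) by (induction rule: dec_induct) (use up in \<open>force+\<close>)
  have antimono: "w j \<le> w i" if "s \<le> i" "i \<le> j" for i j
    using that(2)
  proof (induction j rule: dec_induct)
    case (step n)
    thus ?case using down[of n] that(1) by linarith
  qed simp
  have 1: "t * sum w (D \<inter> {..s}) \<le> t * \<beta> + sum w {..s}"
    by (rule sum_separated_mono[OF t]) (use sep nonneg mono \<beta> in auto)
  have 2: "t * sum w (D - {..s}) \<le> t * \<beta> + sum w {Suc s..<Suc (max s x)}"
    by (rule sum_separated_antimono[OF _ t]) (use fin sub sep nonneg antimono \<beta> in auto)
  have "sum w D = sum w (D \<inter> {..s}) + sum w (D - {..s})"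
    using fin by (rule sum.Int_Diff)
  hence "t * sum w D \<le> 2 * t * \<beta> + (sum w {..s} + sum w {Suc s..<Suc (max s x)})"
    using 1 2 by (simp add: algebra_simps)
  also have "sum w {..s} + sum w {Suc s..<Suc (max s x)} = sum w ({..s} \<union> {Suc s..<Suc (max s x)})"
    by (rule sum.union_disjoint[symmetric]) auto
  also have "\<dots> = sum w {..x}"
    by (rule sum.mono_neutral_right) (auto simp: w_def)
  also have "\<dots> = real (a + c) ^ x" by (simp add: w_def binomial_ring)
  finally have "t * sum w D \<le> 2 * t * \<beta> + real (a + c) ^ x" .
  thus ?thesis using t by (simp add: field_simps)
qed

section \<open>Random permutations\<close>

text \<open>Composing on the left with a permutation that sends \<open>a\<close> to
  \<open>a'\<close> and \<open>b\<close> to \<open>b'\<close> is injective. The first transposition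
  moves \<open>a\<close> to \<open>a'\<close> and leaves \<open>b\<close> at \<open>c\<close>; the
  second moves \<open>c\<close> to \<open>b'\<close> without disturbing \<open>a'\<close>.
  Exchanging the roles gives equality.\<close>

lemma card_permutes_two_points_le:
  assumes S: "finite S" and ab: "a \<in> S" "b \<in> S" "a \<noteq> b" and ab': "a' \<in> S" "b' \<in> S" "a' \<noteq> b'"
  shows "card {\<sigma>. \<sigma> permutes S \<and> \<sigma> i = a \<and> \<sigma> j = b} \<le> card {\<sigma>. \<sigma> permutes S \<and> \<sigma> i = a' \<and> \<sigma> j = b'}"
proof -
  define c where "c = Transposition.transpose a a' b"
  define \<tau> where "\<tau> = Transposition.transpose c b' \<circ> Transposition.transpose a a'"
  have c: "c \<in> S" "c \<noteq> a'" using ab ab' by (auto simp: c_def Transposition.transpose_def)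
  have \<tau>: "\<tau> permutes S" unfolding \<tau>_def
    by (intro permutes_compose permutes_swap_id) (use ab ab' c in auto)
  have v: "\<tau> a = a'" "\<tau> b = b'" using c ab ab' by (auto simp: \<tau>_def c_def Transposition.transpose_def)
  show ?thesis
  proof (rule card_inj_on_le[where f = "\<lambda>\<sigma>. \<tau> \<circ> \<sigma>"])
    show "inj_on (\<lambda>\<sigma>. \<tau> \<circ> \<sigma>) {\<sigma>. \<sigma> permutes S \<and> \<sigma> i = a \<and> \<sigma> j = b}"
      using permutes_inj[OF \<tau>] by (auto simp: inj_on_def fun_eq_iff dest: injD)
    show "(\<lambda>\<sigma>. \<tau> \<circ> \<sigma>) ` {\<sigma>. \<sigma> permutes S \<and> \<sigma> i = a \<and> \<sigma> j = b} \<subseteq> {\<sigma>. \<sigma> permutes S \<and> \<sigma> i = a' \<and> \<sigma> j = b'}"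
      using \<tau> v by (auto intro: permutes_compose)
    show "finite {\<sigma>. \<sigma> permutes S \<and> \<sigma> i = a' \<and> \<sigma> j = b'}"
      by (rule finite_subset[OF _ finite_permutations[OF S]]) auto
  qed
qed

lemma card_permutes_one_point_le:
  assumes S: "finite S" and a: "a \<in> S" "a' \<in> S"
  shows "card {\<sigma>. \<sigma> permutes S \<and> \<sigma> i = a} \<le> card {\<sigma>. \<sigma> permutes S \<and> \<sigma> i = a'}"
proof -
  define \<tau> where "\<tau> = Transposition.transpose a a'"
  have \<tau>: "\<tau> permutes S" unfolding \<tau>_def by (intro permutes_swap_id a)
  show ?thesis
  proof (rule card_inj_on_le[where f = "\<lambda>\<sigma>. \<tau> \<circ> \<sigma>"])
    show "inj_on (\<lambda>\<sigma>. \<tau> \<circ> \<sigma>) {\<sigma>. \<sigma> permutes S \<and> \<sigma> i = a}"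
      using permutes_inj[OF \<tau>] by (auto simp: inj_on_def fun_eq_iff dest: injD)
    show "(\<lambda>\<sigma>. \<tau> \<circ> \<sigma>) ` {\<sigma>. \<sigma> permutes S \<and> \<sigma> i = a} \<subseteq> {\<sigma>. \<sigma> permutes S \<and> \<sigma> i = a'}"
      using \<tau> by (auto intro: permutes_compose simp: \<tau>_def)
    show "finite {\<sigma>. \<sigma> permutes S \<and> \<sigma> i = a'}"
      by (rule finite_subset[OF _ finite_permutations[OF S]]) auto
  qed
qed

text \<open>All fibres of the map taking \<open>\<sigma>\<close> to \<open>\<sigma> i\<close> have
  the same size, found by taking all of \<open>S\<close> as target.\<close>

lemma card_permutes_point_in:
  assumes S: "finite S" and i: "i \<in> S" and A: "A \<subseteq> S"
  shows "real (card {\<sigma>. \<sigma> permutes S \<and> \<sigma> i \<in> A}) = fact (card S) * card A / card S"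
proof -
  define f where "f = (\<lambda>a. card {\<sigma>. \<sigma> permutes S \<and> \<sigma> i = a})"
  have fin: "finite {\<sigma>. \<sigma> permutes S \<and> Q \<sigma>}" for Q
    by (rule finite_subset[OF _ finite_permutations[OF S]]) auto
  have f_eq: "f a = f i" if "a \<in> S" for a
    unfolding f_def using card_permutes_one_point_le[OF S] that i by (meson antisym)
  have union: "card {\<sigma>. \<sigma> permutes S \<and> \<sigma> i \<in> B} = card B * f i" if "B \<subseteq> S" for B
  proof -
    have "{\<sigma>. \<sigma> permutes S \<and> \<sigma> i \<in> B} = (\<Union>a\<in>B. {\<sigma>. \<sigma> permutes S \<and> \<sigma> i = a})" by auto
    also have "card \<dots> = (\<Sum>a\<in>B. f a)" unfolding f_def
      by (rule card_UN_disjoint) (use that S fin finite_subset in auto)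
    also have "\<dots> = card B * f i" using f_eq that by (simp add: subset_iff)
    finally show ?thesis .
  qed
  have "{\<sigma>. \<sigma> permutes S \<and> \<sigma> i \<in> S} = {\<sigma>. \<sigma> permutes S}" using i by (auto simp: permutes_in_image)
  hence "card S * f i = fact (card S)" using union[of S] S by (simp add: card_permutations)
  hence "real (card S) * real (f i) = fact (card S)" by (metis of_nat_fact of_nat_mult)
  moreover have "card S \<noteq> 0" using S i by auto
  ultimately show ?thesis using union[OF A] by (simp add: field_simps)
qed

text \<open>As \<open>A\<close> lies in \<open>B\<close>, the exact probability is
  \<open>a (b - 1) / (N (N - 1))\<close>, and \<open>b \<le> N\<close> bounds it by the product of
  the two single probabilities.\<close>

lemma card_permutes_two_points_in:
  fixes S :: "'a set"
  assumes S: "finite S" and i: "i \<in> S" "j \<in> S" "i \<noteq> j" and A: "A \<subseteq> B" "B \<subseteq> S"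
  shows "real (card {\<sigma>. \<sigma> permutes S \<and> \<sigma> i \<in> A \<and> \<sigma> j \<in> B}) \<le> fact (card S) * card A * card B / (card S)\<^sup>2"
proof -
  define f where "f = (\<lambda>(a, b). card {\<sigma>. \<sigma> permutes S \<and> \<sigma> i = a \<and> \<sigma> j = b})"
  define off where "off = (\<lambda>A (B :: 'a set). SIGMA a:A. B - {a})"
  have fin: "finite {\<sigma>. \<sigma> permutes S \<and> Q \<sigma>}" for Q
    by (rule finite_subset[OF _ finite_permutations[OF S]]) auto
  have f_eq: "f p = f (i, j)" if "p \<in> off S S" for p
    unfolding f_def using card_permutes_two_points_le[OF S, of "fst p" "snd p" i j i j]
      card_permutes_two_points_le[OF S, of i j "fst p" "snd p" i j] that i
    by (auto simp: off_def intro!: antisym)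
  have union: "card {\<sigma>. \<sigma> permutes S \<and> \<sigma> i \<in> A \<and> \<sigma> j \<in> B} = card A * (card B - 1) * f (i, j)"
    if AB: "A \<subseteq> B" "B \<subseteq> S" for A B
  proof -
    have finAB: "finite A" "finite B" using finite_subset[OF AB(2) S] finite_subset[OF AB(1)] by auto
    have "{\<sigma>. \<sigma> permutes S \<and> \<sigma> i \<in> A \<and> \<sigma> j \<in> B} =
        (\<Union>p\<in>off A B. {\<sigma>. \<sigma> permutes S \<and> \<sigma> i = fst p \<and> \<sigma> j = snd p})"
      using i by (auto simp: off_def permutes_inj[THEN inj_eq])
    also have "card \<dots> = (\<Sum>p\<in>off A B. card {\<sigma>. \<sigma> permutes S \<and> \<sigma> i = fst p \<and> \<sigma> j = snd p})"
      by (rule card_UN_disjoint) (use finAB fin in \<open>auto simp: off_def\<close>)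
    also have "\<dots> = (\<Sum>p\<in>off A B. f p)" by (simp add: f_def case_prod_unfold)
    also have "\<dots> = (\<Sum>p\<in>off A B. f (i, j))"
      by (rule sum.cong[OF refl f_eq]) (use AB in \<open>auto simp: off_def\<close>)
    also have "\<dots> = card (off A B) * f (i, j)" by simp
    also have "card (off A B) = (\<Sum>a\<in>A. card (B - {a}))" unfolding off_def
      using finAB by (intro card_SigmaI) auto
    also have "\<dots> = card A * (card B - 1)" using AB by (simp add: subset_iff)
    finally show ?thesis .
  qed
  define N a b where "N = real (card S)" "a = real (card A)" "b = real (card B)"
  have "card S \<ge> card {i, j}" by (rule card_mono) (use S i in auto)
  hence N2: "N \<ge> 2" using i by (simp add: N_a_b_def)
  have "{\<sigma>. \<sigma> permutes S \<and> \<sigma> i \<in> S \<and> \<sigma> j \<in> S} = {\<sigma>. \<sigma> permutes S}" using i by (auto simp: permutes_in_image)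
  hence "card S * (card S - 1) * f (i, j) = fact (card S)"
    using union[of S S] S by (simp add: card_permutations)
  hence "real (card S * (card S - 1) * f (i, j)) = fact (card S)" by (metis of_nat_fact)
  hence F: "N * (N - 1) * f (i, j) = fact (card S)" using N2 by (simp add: N_a_b_def of_nat_diff)
  have bN: "b \<le> N" using card_mono[OF S A(2)] by (simp add: N_a_b_def)
  show ?thesis
  proof (cases "card B = 0")
    case True
    hence "B = {}" using A S finite_subset by fastforce
    thus ?thesis by simp
  next
    case False
    hence "real (card {\<sigma>. \<sigma> permutes S \<and> \<sigma> i \<in> A \<and> \<sigma> j \<in> B}) = a * (b - 1) * f (i, j)"
      using union[OF A] by (simp add: N_a_b_def of_nat_diff)
    also have "\<dots> = fact (card S) * a * ((b - 1) / (N * (N - 1)))"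
      using N2 by (simp add: F[symmetric])
    also have "\<dots> \<le> fact (card S) * a * (b / N\<^sup>2)"
    proof (intro mult_left_mono)
      show "(b - 1) / (N * (N - 1)) \<le> b / N\<^sup>2"
        using N2 bN by (simp add: divide_simps power2_eq_square) (simp add: algebra_simps)
    qed (simp add: N_a_b_def)
    finally show ?thesis by (simp add: N_a_b_def)
  qed
qed

lemma card_markov:
  fixes f :: "'b \<Rightarrow> real"
  assumes "finite \<Omega>" "\<And>\<omega>. \<omega> \<in> \<Omega> \<Longrightarrow> 0 \<le> f \<omega>" "\<And>\<omega>. \<omega> \<in> \<Omega> \<Longrightarrow> Q \<omega> \<Longrightarrow> t \<le> f \<omega>" "0 < t"
  shows "card {\<omega> \<in> \<Omega>. Q \<omega>} \<le> sum f \<Omega> / t"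
proof -
  have "t * card {\<omega> \<in> \<Omega>. Q \<omega>} = (\<Sum>\<omega>\<in>{\<omega> \<in> \<Omega>. Q \<omega>}. t)" by simp
  also have "\<dots> \<le> (\<Sum>\<omega>\<in>{\<omega> \<in> \<Omega>. Q \<omega>}. f \<omega>)" by (rule sum_mono) (use assms in auto)
  also have "\<dots> \<le> sum f \<Omega>" by (rule sum_mono2) (use assms in auto)
  finally show ?thesis using assms(4) by (simp add: field_simps)
qed

text \<open>Chebyshev: the number of hits is hypergeometric, with variance at most its mean.\<close>

lemma card_permutes_few_hits:
  assumes S: "finite S" and K: "K \<subseteq> S" and A: "A \<subseteq> S"
    and \<mu>: "\<mu> = card K * card A / card S" "0 < \<mu>"
  shows "card {\<sigma>. \<sigma> permutes S \<and> card {i \<in> K. \<sigma> i \<in> A} \<le> \<mu> / 2} \<le> fact (card S) * (4 / \<mu>)"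
proof -
  define \<Omega> where "\<Omega> = {\<sigma>. \<sigma> permutes S}"
  define h where "h = (\<lambda>\<sigma>. real (card {i \<in> K. \<sigma> i \<in> A}))"
  define F :: real where "F = fact (card S)"
  have fin: "finite \<Omega>" unfolding \<Omega>_def by (rule finite_permutations[OF S])
  have finK: "finite K" using K S finite_subset by blast
  have c\<Omega>: "real (card \<Omega>) = F" using S by (simp add: \<Omega>_def F_def card_permutations)
  have h: "h \<sigma> = (\<Sum>i\<in>K. of_bool (\<sigma> i \<in> A))" for \<sigma>
    using finK by (simp add: h_def sum.If_cases of_bool_def Int_def)
  have one: "(\<Sum>\<sigma>\<in>\<Omega>. of_bool (\<sigma> i \<in> A)) = F * card A / card S" if "i \<in> K" for i
  proof -
    have "(\<Sum>\<sigma>\<in>\<Omega>. of_bool (\<sigma> i \<in> A)) = real (card {\<sigma> \<in> \<Omega>. \<sigma> i \<in> A})"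
      using fin by (simp add: sum.If_cases of_bool_def Int_def)
    thus ?thesis using card_permutes_point_in[OF S _ A, of i] K that by (auto simp: \<Omega>_def F_def)
  qed
  \<comment> \<open>Hits at distinct positions are not positively correlated, so only the diagonal
    exceeds the squared mean.\<close>
  have two: "(\<Sum>\<sigma>\<in>\<Omega>. of_bool (\<sigma> i \<in> A) * of_bool (\<sigma> j \<in> A)) \<le>
      F * (card A / card S)\<^sup>2 + (if i = j then F * card A / card S else 0)" if "i \<in> K" "j \<in> K" for i j
  proof (cases "i = j")
    case True
    have "0 \<le> F * (card A / card S)\<^sup>2" by (simp add: F_def)
    thus ?thesis using True one[of i] that by (simp flip: of_bool_conj)
  next
    case False
    have "(\<Sum>\<sigma>\<in>\<Omega>. of_bool (\<sigma> i \<in> A) * of_bool (\<sigma> j \<in> A)) = real (card {\<sigma> \<in> \<Omega>. \<sigma> i \<in> A \<and> \<sigma> j \<in> A})"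
      unfolding of_bool_conj[symmetric] using fin by (simp add: sum.If_cases of_bool_def Int_def)
    also have "\<dots> \<le> F * card A * card A / (card S)\<^sup>2"
      using card_permutes_two_points_in[OF S _ _ False, of A A] A K that by (auto simp: \<Omega>_def F_def)
    finally show ?thesis using False by (simp add: power_divide power2_eq_square)
  qed
  have m1: "(\<Sum>\<sigma>\<in>\<Omega>. h \<sigma>) = F * \<mu>"
  proof -
    have "(\<Sum>\<sigma>\<in>\<Omega>. h \<sigma>) = (\<Sum>i\<in>K. \<Sum>\<sigma>\<in>\<Omega>. of_bool (\<sigma> i \<in> A))" unfolding h by (rule sum.swap)
    also have "\<dots> = (\<Sum>i\<in>K. F * card A / card S)" by (rule sum.cong[OF refl one])
    finally show ?thesis by (simp add: \<mu>)
  qed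
  have m2: "(\<Sum>\<sigma>\<in>\<Omega>. (h \<sigma>)\<^sup>2) \<le> F * \<mu>\<^sup>2 + F * \<mu>"
  proof -
    have "(\<Sum>\<sigma>\<in>\<Omega>. (h \<sigma>)\<^sup>2) = (\<Sum>\<sigma>\<in>\<Omega>. \<Sum>i\<in>K. \<Sum>j\<in>K. of_bool (\<sigma> i \<in> A) * of_bool (\<sigma> j \<in> A))"
      unfolding h power2_eq_square sum_product ..
    also have "\<dots> = (\<Sum>i\<in>K. \<Sum>j\<in>K. \<Sum>\<sigma>\<in>\<Omega>. of_bool (\<sigma> i \<in> A) * of_bool (\<sigma> j \<in> A))"
      by (subst sum.swap, rule sum.cong[OF refl], rule sum.swap)
    also have "\<dots> \<le> (\<Sum>i\<in>K. \<Sum>j\<in>K. F * (card A / card S)\<^sup>2 + (if i = j then F * card A / card S else 0))"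
      by (intro sum_mono two)
    also have "\<dots> = F * \<mu>\<^sup>2 + F * \<mu>"
      using finK by (simp add: sum.distrib \<mu> power2_eq_square algebra_simps)
    finally show ?thesis .
  qed
  have "real (card {\<sigma> \<in> \<Omega>. h \<sigma> \<le> \<mu> / 2}) \<le> (\<Sum>\<sigma>\<in>\<Omega>. (h \<sigma> - \<mu>)\<^sup>2) / (\<mu> / 2)\<^sup>2"
  proof (rule card_markov[OF fin])
    fix \<sigma> assume "h \<sigma> \<le> \<mu> / 2"
    hence "\<mu> / 2 \<le> \<mu> - h \<sigma>" by simp
    hence "(\<mu> / 2)\<^sup>2 \<le> (\<mu> - h \<sigma>)\<^sup>2" by (rule power_mono) (use \<mu> in simp)
    thus "(\<mu> / 2)\<^sup>2 \<le> (h \<sigma> - \<mu>)\<^sup>2" by (simp add: power2_commute)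
  qed (use \<mu>(2) in auto)
  also have "(\<Sum>\<sigma>\<in>\<Omega>. (h \<sigma> - \<mu>)\<^sup>2) = (\<Sum>\<sigma>\<in>\<Omega>. (h \<sigma>)\<^sup>2) + F * \<mu>\<^sup>2 - 2 * \<mu> * (\<Sum>\<sigma>\<in>\<Omega>. h \<sigma>)"
    by (simp add: power2_diff sum.distrib sum_subtractf c\<Omega> mult_ac flip: sum_distrib_left sum_distrib_right)
  also have "\<dots> \<le> F * \<mu>" using m2 unfolding m1 by (simp add: power2_eq_square)
  finally have "real (card {\<sigma> \<in> \<Omega>. h \<sigma> \<le> \<mu> / 2}) \<le> F * \<mu> / (\<mu> / 2)\<^sup>2"
    by (simp add: divide_right_mono)
  also have "\<dots> = F * (4 / \<mu>)" using \<mu>(2) by (simp add: power2_eq_square)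
  finally show ?thesis by (simp add: \<Omega>_def h_def F_def)
qed

section \<open>Stable splits of a sequence\<close>

locale adjacency =
  fixes adj :: "'a \<Rightarrow> 'a \<Rightarrow> bool"
  assumes adj_sym: "adj x y \<Longrightarrow> adj y x" and adj_irrefl: "\<not> adj x x"
begin

text \<open>Counts ordered pairs, so \<open>cross v v\<close> is twice the number of edges spanned by \<open>v\<close>.\<close>

definition cross :: "'a list \<Rightarrow> 'a list \<Rightarrow> nat" where
  "cross xs ys = (\<Sum>x\<leftarrow>xs. \<Sum>y\<leftarrow>ys. of_bool (adj x y))"

lemma cross_append_left: "cross (xs @ xs') ys = cross xs ys + cross xs' ys"
  by (simp add: cross_def)

lemma cross_append_right: "cross xs (ys @ ys') = cross xs ys + cross xs ys'"
  by (simp add: cross_def sum_list_addf)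

lemma cross_commute: "cross xs ys = cross ys xs"
proof -
  have "adj x y = adj y x" for x y using adj_sym by blast
  moreover have "cross xs ys = (\<Sum>y\<leftarrow>ys. \<Sum>x\<leftarrow>xs. of_bool (adj x y))"
    by (induction xs) (simp_all add: cross_def sum_list_addf)
  ultimately show ?thesis unfolding cross_def by simp
qed

lemma cross_cong_mset:
  assumes "mset xs = mset xs'" "mset ys = mset ys'"
  shows "cross xs ys = cross xs' ys'"
proof -
  have "cross xs ys = (\<Sum>x\<in>#mset xs. \<Sum>y\<in>#mset ys. of_bool (adj x y))" for xs ys
    unfolding cross_def by (simp flip: sum_mset_sum_list mset_map)
  thus ?thesis using assms by simp
qed

lemma cross_self_append:
  "cross (xs @ ys) (xs @ ys) = cross xs xs + 2 * cross xs ys + cross ys ys"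
  using cross_commute[of ys xs] by (simp add: cross_append_left cross_append_right)

lemma cross_pos:
  assumes "x \<in> set xs" "y \<in> set ys" "adj x y"
  shows "0 < cross xs ys"
proof -
  have "(\<Sum>y\<leftarrow>ys. of_bool (adj x y)) \<noteq> (0 :: nat)"
    using assms by (auto simp: sum_list_eq_0_iff)
  thus ?thesis using assms unfolding cross_def by (auto simp: sum_list_eq_0_iff simp flip: neq0_conv)
qed

lemma cross_eq_0:
  assumes "\<And>x y. x \<in> set xs \<Longrightarrow> y \<in> set ys \<Longrightarrow> \<not> adj x y"
  shows "cross xs ys = 0"
  using assms by (auto simp: cross_def sum_list_eq_0_iff)

text \<open>Every entry of \<open>us'\<close> brings an edge to \<open>as\<close>, and appending
  entries never removes edges, so the increase is strict whatever \<open>ws'\<close> is.\<close>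

lemma cross_self_strict_mono:
  assumes "us' \<noteq> []" "\<And>u. u \<in> set us' \<Longrightarrow> \<exists>a\<in>set as. adj a u"
  shows "cross (as @ us @ ws) (as @ us @ ws) < cross (as @ (us @ us') @ (ws @ ws')) (as @ (us @ us') @ (ws @ ws'))"
proof -
  obtain u where u: "u \<in> set us'" using assms(1) by (meson list.set_sel(1))
  then obtain a where a: "a \<in> set as" "adj a u" using assms(2) by blast
  have "cross (as @ (us @ us') @ (ws @ ws')) (as @ (us @ us') @ (ws @ ws')) =
     cross ((as @ us @ ws) @ (us' @ ws')) ((as @ us @ ws) @ (us' @ ws'))"
    by (rule cross_cong_mset) auto
  moreover have "0 < cross (as @ us @ ws) (us' @ ws')"
    by (rule cross_pos[of a _ u]) (use a u in auto)
  ultimately show ?thesis by (simp only: cross_self_append)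
qed

definition touches :: "'a list \<Rightarrow> 'a \<Rightarrow> bool" where
  "touches as v \<longleftrightarrow> (\<exists>a\<in>set as. adj a v)"

text \<open>
  Deleting the last \<open>T\<close> entries of \<open>ws\<close> must not change the number of edges; this is what forces
  the lengths of \<open>us\<close> occurring along a fixed pair of sequences to be \<open>T\<close>-separated.
\<close>

definition stable_part :: "nat \<Rightarrow> real \<Rightarrow> real \<Rightarrow> nat \<Rightarrow> 'a list \<Rightarrow> 'a list \<Rightarrow> 'a list \<Rightarrow> bool" where
  "stable_part L M M' T as us ws \<longleftrightarrow>
     cross (as @ us @ ws) (as @ us @ ws) = L \<and> M \<le> length us \<and> M' \<le> length ws \<and> T \<le> length ws \<and>
     (let ws' = take (length ws - T) ws in cross (as @ us @ ws') (as @ us @ ws') = L)"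

definition stable_split :: "nat \<Rightarrow> real \<Rightarrow> real \<Rightarrow> nat \<Rightarrow> 'a list \<Rightarrow> 'a list \<Rightarrow> bool" where
  "stable_split L M M' T as bs \<longleftrightarrow>
     stable_part L M M' T as (filter (touches as) bs) (filter (\<lambda>v. \<not> touches as v) bs)"

end

section \<open>Sequences as interleavings of touching and non-touching entries\<close>

definition lists_of :: "'a set \<Rightarrow> nat \<Rightarrow> 'a list set" where
  "lists_of A n = {xs. set xs \<subseteq> A \<and> length xs = n}"

lemma finite_lists_of: "finite A \<Longrightarrow> finite (lists_of A n)"
  by (simp add: lists_of_def finite_lists_length_eq)

lemma card_lists_of: "finite A \<Longrightarrow> card (lists_of A n) = card A ^ n"
  by (simp add: lists_of_def card_lists_length_eq)

text \<open>A sequence is a shuffle of its two filtered parts, and disjoint parts of lengths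
  \<open>q\<close> and \<open>x - q\<close> have \<open>x choose q\<close> shuffles. So, given the
  binomial number \<open>q\<close>, the two parts are independent uniform sequences.\<close>

lemma card_filter_lists_of:
  fixes \<Phi> :: "'a list \<Rightarrow> 'a list \<Rightarrow> bool" and P :: "'a \<Rightarrow> bool"
  assumes V: "finite V"
  defines "VP \<equiv> {v \<in> V. P v}" and "VZ \<equiv> {v \<in> V. \<not> P v}"
  shows "card {bs \<in> lists_of V x. \<Phi> (filter P bs) (filter (\<lambda>v. \<not> P v) bs)} =
    (\<Sum>q\<le>x. (x choose q) * card {(us, ws) \<in> lists_of VP q \<times> lists_of VZ (x - q). \<Phi> us ws})"
proof -
  define X where "X = (\<lambda>q. {(us, ws) \<in> lists_of VP q \<times> lists_of VZ (x - q). \<Phi> us ws})"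
  have fin: "finite VP" "finite VZ" using V by (auto simp: VP_def VZ_def)
  have finX: "finite (X q)" for q unfolding X_def
    by (rule finite_subset[of _ "lists_of VP q \<times> lists_of VZ (x - q)"]) (auto intro: finite_lists_of fin)
  have sh: "partition P -` {(us, ws)} = shuffles us ws" if "set us \<subseteq> VP" "set ws \<subseteq> VZ" for us ws
    by (rule inv_image_partition) (use that in \<open>auto simp: VP_def VZ_def\<close>)
  have "{bs \<in> lists_of V x. \<Phi> (filter P bs) (filter (\<lambda>v. \<not> P v) bs)} =
      (\<Union>p\<in>(\<Union>q\<le>x. X q). shuffles (fst p) (snd p))"
  proof (intro equalityI subsetI)
    fix bs assume bs: "bs \<in> {bs \<in> lists_of V x. \<Phi> (filter P bs) (filter (\<lambda>v. \<not> P v) bs)}"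
    hence "bs \<in> shuffles (filter P bs) (filter (\<lambda>v. \<not> P v) bs)" by (simp add: partition_in_shuffles)
    moreover have "length (filter P bs) + length (filter (\<lambda>v. \<not> P v) bs) = x"
      using bs sum_length_filter_compl[of P bs] by (simp add: lists_of_def)
    hence "(filter P bs, filter (\<lambda>v. \<not> P v) bs) \<in> X (length (filter P bs))" "length (filter P bs) \<le> x"
      using bs by (auto simp: X_def lists_of_def VP_def VZ_def)
    ultimately show "bs \<in> (\<Union>p\<in>(\<Union>q\<le>x. X q). shuffles (fst p) (snd p))" by fastforce
  next
    fix bs assume "bs \<in> (\<Union>p\<in>(\<Union>q\<le>x. X q). shuffles (fst p) (snd p))"
    then obtain q us ws where *: "q \<le> x" "(us, ws) \<in> X q" "bs \<in> shuffles us ws" by auto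
    hence s: "set us \<subseteq> VP" "set ws \<subseteq> VZ" by (auto simp: X_def lists_of_def)
    have "filter P bs = us" "filter (\<lambda>v. \<not> P v) bs = ws"
      using *(3) unfolding sh[OF s, symmetric] by (auto simp: comp_def)
    moreover have "set bs \<subseteq> V" using set_shuffles[OF *(3)] s by (auto simp: VP_def VZ_def)
    moreover have "length bs = x" using length_shuffles[OF *(3)] * by (auto simp: X_def lists_of_def)
    ultimately show "bs \<in> {bs \<in> lists_of V x. \<Phi> (filter P bs) (filter (\<lambda>v. \<not> P v) bs)}"
      using * by (auto simp: X_def lists_of_def)
  qed
  also have "card \<dots> = (\<Sum>p\<in>(\<Union>q\<le>x. X q). card (shuffles (fst p) (snd p)))"
  proof (rule card_UN_disjoint)
    show "\<forall>i\<in>\<Union> (X ` {..x}). \<forall>j\<in>\<Union> (X ` {..x}). i \<noteq> j \<longrightarrow> shuffles (fst i) (snd i) \<inter> shuffles (fst j) (snd j) = {}"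
    proof (intro ballI impI)
      fix i j assume ij: "i \<in> \<Union> (X ` {..x})" "j \<in> \<Union> (X ` {..x})" "i \<noteq> j"
      have "shuffles (fst p) (snd p) = partition P -` {p}" if "p \<in> \<Union> (X ` {..x})" for p
      proof -
        have "set (fst p) \<subseteq> VP" "set (snd p) \<subseteq> VZ" using that by (auto simp: X_def lists_of_def)
        from sh[OF this] show ?thesis by simp
      qed
      thus "shuffles (fst i) (snd i) \<inter> shuffles (fst j) (snd j) = {}" using ij by auto
    qed
  qed (use finX in auto)
  also have "\<dots> = (\<Sum>p\<in>(\<Union>q\<le>x. X q). x choose length (fst p))"
  proof (rule sum.cong[OF refl])
    fix p assume "p \<in> (\<Union>q\<le>x. X q)"
    then obtain q where q: "q \<le> x" "p \<in> X q" by auto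
    hence "set (fst p) \<subseteq> VP" "set (snd p) \<subseteq> VZ" "length (fst p) = q" "length (snd p) = x - q"
      by (auto simp: X_def lists_of_def)
    moreover from this have "set (fst p) \<inter> set (snd p) = {}" by (auto simp: VP_def VZ_def)
    ultimately show "card (shuffles (fst p) (snd p)) = x choose length (fst p)"
      using q by (simp add: card_disjoint_shuffles)
  qed
  also have "\<dots> = (\<Sum>q\<le>x. \<Sum>p\<in>X q. x choose length (fst p))"
    by (rule sum.UNION_disjoint) (use finX in \<open>auto simp: X_def lists_of_def\<close>)
  also have "\<dots> = (\<Sum>q\<le>x. \<Sum>p\<in>X q. x choose q)"
    by (intro sum.cong refl) (auto simp: X_def lists_of_def)
  finally show ?thesis by (simp add: X_def mult.commute)
qed

text \<open>The added tails are unrestricted. Extending both parts to length \<open>x\<close> lets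
  every \<open>q\<close> be read off from prefixes of one common pair \<open>(U, W)\<close>.\<close>

lemma card_extend_lists_of:
  assumes A: "finite A" and B: "finite B" and q: "q \<le> x" and r: "r \<le> x"
  shows "card {(us, ws) \<in> lists_of A q \<times> lists_of B r. \<Phi> us ws} * (card A ^ (x - q) * card B ^ (x - r)) =
    card {(U, W) \<in> lists_of A x \<times> lists_of B x. \<Phi> (take q U) (take r W)}"
proof -
  define X where "X = {(us, ws) \<in> lists_of A q \<times> lists_of B r. \<Phi> us ws}"
  have "bij_betw (\<lambda>((us, ws), (us', ws')). (us @ us', ws @ ws')) (X \<times> (lists_of A (x - q) \<times> lists_of B (x - r)))
    {(U, W) \<in> lists_of A x \<times> lists_of B x. \<Phi> (take q U) (take r W)}"
    by (rule bij_betw_byWitness[where f' = "\<lambda>(U, W). ((take q U, take r W), (drop q U, drop r W))"])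
       (use q r in \<open>auto simp: X_def lists_of_def dest: in_set_takeD in_set_dropD\<close>)
  from bij_betw_same_card[OF this] show ?thesis
    using A B by (simp add: card_cartesian_product card_lists_of X_def)
qed

context adjacency
begin

text \<open>For each fixed pair \<open>(U, W)\<close> the admissible values of \<open>q\<close> are
  \<open>T\<close>-separated, so their total binomial weight is bounded as above. The lower bounds
  \<open>M\<close> and \<open>M'\<close> on the lengths cap a single weight.\<close>

lemma card_stable_split_le:
  assumes V: "finite V" and M: "0 < M" and M': "0 < M'" and T: "1 \<le> T"
  shows "card {bs \<in> lists_of V x. stable_split L M M' T as bs} \<le>
    real (card V) ^ x * (2 * sqrt (x / (M * M')) + 1 / T)"
proof -
  define P where "P = touches as"
  define VP where "VP = {v \<in> V. P v}"
  define VZ where "VZ = {v \<in> V. \<not> P v}"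
  define a where "a = card VP"
  define c where "c = card VZ"
  define \<Phi> where "\<Phi> = stable_part L M M' T as"
  define B where "B = {bs \<in> lists_of V x. \<Phi> (filter P bs) (filter (\<lambda>v. \<not> P v) bs)}"
  define w where "w = (\<lambda>q. (x choose q) * real a ^ q * real c ^ (x - q))"
  have fin: "finite VP" "finite VZ" using V by (auto simp: VP_def VZ_def)
  have ac: "a + c = card V"
  proof -
    have "card (VP \<union> VZ) = a + c" unfolding a_def c_def
      by (rule card_Un_disjoint) (use fin in \<open>auto simp: VP_def VZ_def\<close>)
    moreover have "VP \<union> VZ = V" by (auto simp: VP_def VZ_def)
    ultimately show ?thesis by simp
  qed
  have nonneg: "0 \<le> real (card V) ^ x * (2 * sqrt (x / (M * M')) + 1 / T)" using M M' by simp
  have \<Phi>D: "us \<noteq> []" "ws \<noteq> []" if "\<Phi> us ws" for us ws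
    using that M M' by (auto simp: \<Phi>_def stable_part_def)
  have "real (card B) \<le> real (card V) ^ x * (2 * sqrt (x / (M * M')) + 1 / T)"
  \<comment> \<open>Positive \<open>M\<close> and \<open>M'\<close> force both parts to be nonempty,
    so neither vertex class can be empty.\<close>
  proof (cases "a = 0 \<or> c = 0")
    case True
    have "B = {}"
    proof (rule ccontr)
      assume "B \<noteq> {}"
      then obtain bs where bs: "set bs \<subseteq> V" "\<Phi> (filter P bs) (filter (\<lambda>v. \<not> P v) bs)"
        by (auto simp: B_def lists_of_def)
      have "set (filter P bs) \<subseteq> VP" "set (filter (\<lambda>v. \<not> P v) bs) \<subseteq> VZ"
        using bs by (auto simp: VP_def VZ_def)
      moreover have "VP = {} \<or> VZ = {}" using True fin by (auto simp: a_def c_def)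
      ultimately show False using \<Phi>D[OF bs(2)] by auto
    qed
    thus ?thesis using nonneg by simp
  next
    case False
    hence pos: "0 < a" "0 < c" by auto
    define Y where "Y = lists_of VP x \<times> lists_of VZ x"
    have finY: "finite Y" unfolding Y_def using fin by (auto intro: finite_lists_of)
    have cY: "card Y = a ^ x * c ^ x" using fin
      by (simp add: Y_def card_cartesian_product card_lists_of a_def c_def)
    define D where "D = (\<lambda>(U, W). {q. q \<le> x \<and> \<Phi> (take q U) (take (x - q) W)})"
    have summand: "real (x choose q) * card {(us, ws) \<in> lists_of VP q \<times> lists_of VZ (x - q). \<Phi> us ws} * (real a ^ x * real c ^ x) =
       w q * card {p \<in> Y. q \<in> D p}" if "q \<le> x" for q
    proof -
      have e: "{p \<in> Y. q \<in> D p} = {(U, W) \<in> lists_of VP x \<times> lists_of VZ x. \<Phi> (take q U) (take (x - q) W)}"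
        using that by (auto simp: Y_def D_def)
      have "real (card {p \<in> Y. q \<in> D p}) =
          card {(us, ws) \<in> lists_of VP q \<times> lists_of VZ (x - q). \<Phi> us ws} * (real a ^ (x - q) * real c ^ q)"
        unfolding e card_extend_lists_of[OF fin that diff_le_self, where \<Phi> = \<Phi>, symmetric] a_def c_def
        by (simp only: of_nat_mult of_nat_power diff_diff_cancel[OF that])
      moreover have "real a ^ x = real a ^ q * real a ^ (x - q)" "real c ^ x = real c ^ (x - q) * real c ^ q"
        using that by (simp_all flip: power_add)
      ultimately show ?thesis by (simp add: w_def)
    qed
    \<comment> \<open>If \<open>q'\<close> were less than \<open>q + T\<close>, then the
      configuration at \<open>q'\<close> would contain the one at \<open>q\<close> with its last
      \<open>T\<close> non-touching entries deleted. The latter still has \<open>cross\<close> value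
      \<open>L\<close> by stability, and the former adds touching entries, so its value would exceed
      \<open>L\<close>.\<close>
    have gap: "q + T \<le> q'" if p: "p \<in> Y" and q: "q \<in> D p" "q' \<in> D p" "q < q'" for p q q'
    proof (rule ccontr)
      assume *: "\<not> q + T \<le> q'"
      obtain U W where UW: "p = (U, W)" by force
      have l: "length U = x" "length W = x" "set U \<subseteq> VP" using p by (auto simp: UW Y_def lists_of_def)
      have qx: "q \<le> x" "q' \<le> x" using q by (auto simp: D_def UW)
      define us' where "us' = take (q' - q) (drop q U)"
      define r where "r = x - q - T"
      define ws' where "ws' = take (x - q' - r) (drop r W)"
      have s1: "stable_part L M M' T as (take q U) (take (x - q) W)"
        and s2: "stable_part L M M' T as (take q' U) (take (x - q') W)"
        using q by (auto simp: D_def UW \<Phi>_def)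
      have "take (x - q - T) (take (x - q) W) = take r W" by (simp add: r_def min_def)
      hence e1: "cross (as @ take q U @ take r W) (as @ take q U @ take r W) = L"
        using s1 l by (simp add: stable_part_def Let_def)
      have u: "take q' U = take q U @ us'" using q(3) unfolding us'_def
        by (metis le_add_diff_inverse less_imp_le take_add)
      have "r \<le> x - q'" using * by (simp add: r_def)
      hence ww: "take (x - q') W = take r W @ ws'" unfolding ws'_def
        by (metis le_add_diff_inverse take_add)
      have e2: "cross (as @ (take q U @ us') @ (take r W @ ws')) (as @ (take q U @ us') @ (take r W @ ws')) = L"
        using s2 unfolding u ww by (simp add: stable_part_def)
      have "us' \<noteq> []" using q qx l by (simp add: us'_def)
      moreover have "\<exists>a\<in>set as. adj a u" if "u \<in> set us'" for u
      proof -
        have "u \<in> set U" using that by (auto simp: us'_def dest: in_set_takeD in_set_dropD)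
        hence "u \<in> VP" using l by auto
        thus ?thesis by (simp add: VP_def P_def touches_def)
      qed
      ultimately show False
        using cross_self_strict_mono[of us' as "take q U" "take r W" ws'] e1 e2 by simp
    qed
    have bnd: "sum w (D p) \<le> 2 * (sqrt (x / (M * M')) * real (card V) ^ x) + real (a + c) ^ x / T" if p: "p \<in> Y" for p
      unfolding w_def
    proof (rule sum_separated_binomial_weight[OF T pos])
      show "D p \<subseteq> {..x}" by (auto simp: D_def split: prod.splits)
      show "\<And>q q'. q \<in> D p \<Longrightarrow> q' \<in> D p \<Longrightarrow> q < q' \<Longrightarrow> q + T \<le> q'" using gap p by blast
      show "0 \<le> sqrt (x / (M * M')) * real (card V) ^ x" using M M' by simp
      fix q assume q: "q \<in> D p"
      obtain U W where UW: "p = (U, W)" by force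
      have l: "length U = x" "length W = x" using p by (auto simp: UW Y_def lists_of_def)
      have qx: "q \<le> x" "M \<le> q" "M' \<le> x - q" using q l by (auto simp: D_def UW \<Phi>_def stable_part_def)
      hence q0: "0 < q" "q < x" using M M' by (auto simp: of_nat_diff)
      have "(x choose q) * real a ^ q * real c ^ (x - q) \<le> sqrt (x / (real q * (real x - real q))) * (real a + real c) ^ x"
        by (rule binomial_weight_le) (use q0 pos in auto)
      also have "\<dots> \<le> sqrt (x / (M * M')) * (real a + real c) ^ x"
      proof (intro mult_right_mono real_sqrt_le_mono divide_left_mono)
        show "M * M' \<le> real q * (real x - real q)" using qx M M' by (auto intro!: mult_mono)
      qed (use q0 M M' in auto)
      finally show "(x choose q) * real a ^ q * real c ^ (x - q) \<le> sqrt (x / (M * M')) * real (card V) ^ x"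
        by (simp flip: ac)
    qed
    have "real (card B) * (real a ^ x * real c ^ x) =
        (\<Sum>q\<le>x. real (x choose q) * card {(us, ws) \<in> lists_of VP q \<times> lists_of VZ (x - q). \<Phi> us ws} * (real a ^ x * real c ^ x))"
      unfolding B_def card_filter_lists_of[OF V] VP_def VZ_def by (simp add: sum_distrib_right)
    also have "\<dots> = (\<Sum>q\<le>x. w q * card {p \<in> Y. q \<in> D p})" by (intro sum.cong refl summand) simp
    also have "\<dots> = (\<Sum>q\<le>x. \<Sum>p\<in>Y. if q \<in> D p then w q else 0)"
      using finY by (simp add: sum.If_cases Int_def mult.commute)
    \<comment> \<open>Exchanging the sums averages over pairs \<open>(U, W)\<close> the weight of
      their admissible \<open>q\<close>.\<close>
    also have "\<dots> = (\<Sum>p\<in>Y. \<Sum>q\<le>x. if q \<in> D p then w q else 0)" by (rule sum.swap)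
    also have "\<dots> = (\<Sum>p\<in>Y. sum w (D p))"
    proof (rule sum.cong[OF refl])
      fix p
      have "{..x} \<inter> D p = D p" by (auto simp: D_def split: prod.splits)
      thus "(\<Sum>q\<le>x. if q \<in> D p then w q else 0) = sum w (D p)"
        by (simp add: sum.If_cases)
    qed
    also have "\<dots> \<le> (\<Sum>p\<in>Y. real (card V) ^ x * (2 * sqrt (x / (M * M')) + 1 / T))"
      by (rule sum_mono) (use bnd in \<open>simp add: ac algebra_simps flip: of_nat_add\<close>)
    also have "\<dots> = real (card V) ^ x * (2 * sqrt (x / (M * M')) + 1 / T) * (real a ^ x * real c ^ x)"
      by (simp add: cY)
    finally show ?thesis using pos by (simp del: of_nat_power)
  qed
  thus ?thesis by (simp add: B_def \<Phi>_def P_def stable_split_def)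
qed

end

section \<open>Non-isolated positions under a random rearrangement\<close>

text \<open>With the inverse in \<open>permute_list\<close>, \<open>\<sigma> i\<close> is the new
  place of the old entry \<open>i\<close>, so that events can be stated through
  \<open>\<sigma>\<close> at the positions of \<open>v\<close>.\<close>

lemma nth_permute_list_inv:
  assumes "\<sigma> permutes {..<length v}" "i < length v"
  shows "permute_list (inv \<sigma>) v ! (\<sigma> i) = v ! i"
proof -
  have "\<sigma> i < length v" using assms permutes_in_image[of \<sigma> "{..<length v}" i] by auto
  thus ?thesis using assms permutes_inv[OF assms(1)]
    by (simp add: permute_list_nth permutes_inverses)
qed

lemma length_filter_drop_permute_list:
  assumes \<sigma>: "\<sigma> permutes {..<length v}"
  shows "length (filter Q (drop d (permute_list (inv \<sigma>) v))) = card {i. i < length v \<and> d \<le> \<sigma> i \<and> Q (v ! i)}"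
proof -
  let ?w = "permute_list (inv \<sigma>) v"
  have lt: "\<sigma> i < length v \<longleftrightarrow> i < length v" for i
    using permutes_in_image[OF \<sigma>, of i] by auto
  have "length (filter Q (drop d ?w)) = card {j. j < length (drop d ?w) \<and> Q (drop d ?w ! j)}"
    by (rule length_filter_conv_card)
  also have "\<dots> = card {i. i < length v \<and> d \<le> \<sigma> i \<and> Q (v ! i)}"
  proof (rule bij_betw_same_card[symmetric], rule bij_betw_imageI)
    show "inj_on (\<lambda>i. \<sigma> i - d) {i. i < length v \<and> d \<le> \<sigma> i \<and> Q (v ! i)}"
    proof (rule inj_onI)
      fix i j assume "i \<in> {i. i < length v \<and> d \<le> \<sigma> i \<and> Q (v ! i)}"
        "j \<in> {i. i < length v \<and> d \<le> \<sigma> i \<and> Q (v ! i)}" "\<sigma> i - d = \<sigma> j - d"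
      hence "\<sigma> i = \<sigma> j" by auto
      thus "i = j" by (rule injD[OF permutes_inj[OF \<sigma>]])
    qed
    show "(\<lambda>i. \<sigma> i - d) ` {i. i < length v \<and> d \<le> \<sigma> i \<and> Q (v ! i)} = {j. j < length (drop d ?w) \<and> Q (drop d ?w ! j)}"
    proof (intro equalityI subsetI)
      fix j assume "j \<in> (\<lambda>i. \<sigma> i - d) ` {i. i < length v \<and> d \<le> \<sigma> i \<and> Q (v ! i)}"
      then obtain i where i: "i < length v" "d \<le> \<sigma> i" "Q (v ! i)" "j = \<sigma> i - d" by auto
      moreover have "\<sigma> i < length v" using lt i by simp
      ultimately show "j \<in> {j. j < length (drop d ?w) \<and> Q (drop d ?w ! j)}"
        using nth_permute_list_inv[OF \<sigma> i(1)] by auto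
    next
      fix j assume j: "j \<in> {j. j < length (drop d ?w) \<and> Q (drop d ?w ! j)}"
      define i where "i = inv \<sigma> (d + j)"
      have si: "\<sigma> i = d + j" using permutes_inverses(1)[OF \<sigma>] by (simp add: i_def)
      have "i < length v" using lt[of i] si j by auto
      moreover from this have "Q (v ! i)" using nth_permute_list_inv[OF \<sigma>, of i] si j by auto
      ultimately show "j \<in> (\<lambda>i. \<sigma> i - d) ` {i. i < length v \<and> d \<le> \<sigma> i \<and> Q (v ! i)}"
        using si by (auto intro!: image_eqI[of _ _ i])
    qed
  qed
  finally show ?thesis .
qed

context adjacency
begin

text \<open>Positions rather than vertices, since a sequence may repeat a vertex.\<close>

definition nonisolated :: "'a list \<Rightarrow> nat set" where
  "nonisolated v = {i. i < length v \<and> (\<exists>j < length v. adj (v ! i) (v ! j))}"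

text \<open>Following one chosen neighbour suffices: a non-isolated entry outside the first block
  that does not touch this block has its chosen neighbour outside too, an event on only two values
  of \<open>\<sigma>\<close>.\<close>

definition neighbour :: "'a list \<Rightarrow> nat \<Rightarrow> nat" where
  "neighbour v i = (SOME j. j < length v \<and> adj (v ! i) (v ! j))"

lemma neighbour:
  assumes "i \<in> nonisolated v"
  shows "neighbour v i < length v" "adj (v ! i) (v ! neighbour v i)" "neighbour v i \<noteq> i"
proof -
  have "\<exists>j. j < length v \<and> adj (v ! i) (v ! j)" using assms by (auto simp: nonisolated_def)
  from someI_ex[OF this] show "neighbour v i < length v" "adj (v ! i) (v ! neighbour v i)"
    by (auto simp: neighbour_def)
  thus "neighbour v i \<noteq> i" using adj_irrefl by metis
qed

lemma finite_nonisolated [simp]: "finite (nonisolated v)"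
  by (simp add: nonisolated_def)

lemma cross_self_nth: "cross v v = (\<Sum>i<length v. \<Sum>j<length v. of_bool (adj (v ! i) (v ! j)))"
  by (simp add: cross_def sum_list_sum_nth atLeast0LessThan)

text \<open>Each non-isolated position is the first coordinate of at least one adjacent ordered
  pair.\<close>

lemma card_nonisolated_le: "card (nonisolated v) \<le> cross v v"
proof -
  have "card (nonisolated v) = (\<Sum>i\<in>nonisolated v. 1)" by simp
  also have "\<dots> \<le> (\<Sum>i\<in>nonisolated v. \<Sum>j<length v. of_bool (adj (v ! i) (v ! j)))"
  proof (rule sum_mono)
    fix i assume "i \<in> nonisolated v"
    note nb = neighbour[OF this]
    have "of_bool (adj (v ! i) (v ! neighbour v i)) \<le> (\<Sum>j<length v. of_bool (adj (v ! i) (v ! j)) :: nat)"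
      by (rule member_le_sum) (use nb in auto)
    thus "1 \<le> (\<Sum>j<length v. of_bool (adj (v ! i) (v ! j)) :: nat)" using nb by simp
  qed
  also have "\<dots> \<le> cross v v" unfolding cross_self_nth
    by (rule sum_mono2) (auto simp: nonisolated_def)
  finally show ?thesis .
qed

text \<open>Both coordinates of an adjacent pair are non-isolated positions.\<close>

lemma cross_le_card_nonisolated: "cross v v \<le> (card (nonisolated v))\<^sup>2"
proof -
  have adjD: "j \<in> nonisolated v" if "i < length v" "j < length v" "adj (v ! i) (v ! j)" for i j
    using that adj_sym by (auto simp: nonisolated_def)
  have "cross v v = (\<Sum>i\<in>nonisolated v. \<Sum>j<length v. of_bool (adj (v ! i) (v ! j)))"
    unfolding cross_self_nth by (rule sum.mono_neutral_right) (auto simp: nonisolated_def)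
  also have "\<dots> = (\<Sum>i\<in>nonisolated v. \<Sum>j\<in>nonisolated v. of_bool (adj (v ! i) (v ! j)))"
    by (rule sum.cong[OF refl], rule sum.mono_neutral_right) (auto simp: nonisolated_def intro: adjD adj_sym)
  also have "\<dots> \<le> (\<Sum>i\<in>nonisolated v. \<Sum>j\<in>nonisolated v. 1)" by (intro sum_mono) auto
  finally show ?thesis by (simp add: power2_eq_square)
qed

text \<open>The deterministic part. A non-isolated entry in the last \<open>x\<close> places touches
  the first block unless its chosen neighbour also lands there, which gives \<open>M\<close>;
  isolated entries never touch, which gives \<open>M'\<close>. By \<open>no\<close>, every
  non-touching entry in the last \<open>y\<close> places is isolated, and there are at least
  \<open>T\<close> of them.\<close>

lemma stable_split_permute_list:
  fixes v :: "'a list" and \<sigma> :: "nat \<Rightarrow> nat" and M M' :: real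
  defines "k \<equiv> length v" and "S \<equiv> nonisolated v"
  assumes \<sigma>: "\<sigma> permutes {..<k}" and yx: "y \<le> x" "x \<le> k" and L: "cross v v = L"
    and M: "M + real (card {i \<in> S. \<sigma> i \<in> {k - x..<k} \<and> \<sigma> (neighbour v i) \<in> {k - x..<k}})
      \<le> real (card {i \<in> S. \<sigma> i \<in> {k - x..<k}})"
    and M': "M' \<le> card {i \<in> {..<k} - S. \<sigma> i \<in> {k - x..<k}}"
    and T: "T \<le> card {i \<in> {..<k} - S. \<sigma> i \<in> {k - y..<k}}"
    and no: "\<And>i. i \<in> S \<Longrightarrow> \<sigma> i \<in> {k - y..<k} \<Longrightarrow> \<sigma> (neighbour v i) \<in> {k - x..<k} \<Longrightarrow> False"
  shows "stable_split L M M' T (take (k - x) (permute_list (inv \<sigma>) v)) (drop (k - x) (permute_list (inv \<sigma>) v))"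
proof -
  define w where "w = permute_list (inv \<sigma>) v"
  define as where "as = take (k - x) w"
  define bs where "bs = drop (k - x) w"
  define P where "P = touches as"
  define us where "us = filter P bs"
  define ws where "ws = filter (\<lambda>v. \<not> P v) bs"
  have \<sigma>': "\<sigma> permutes {..<length v}" using \<sigma> by (simp add: k_def)
  have lw: "length w = k" by (simp add: w_def k_def)
  have mw: "mset w = mset v" unfolding w_def
    by (rule mset_permute_list) (rule permutes_inv[OF \<sigma>'])
  have lt: "\<sigma> i < k \<longleftrightarrow> i < k" for i using permutes_in_image[OF \<sigma>, of i] by auto
  have nth: "w ! \<sigma> i = v ! i" if "i < k" for i
    unfolding w_def by (rule nth_permute_list_inv[OF \<sigma>']) (use that in \<open>simp add: k_def\<close>)
  have Sk: "S \<subseteq> {..<k}" by (auto simp: S_def nonisolated_def k_def)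
  have finS: "finite S" by (simp add: S_def)
  have iso: "\<not> adj (v ! i) z" if "i < k" "i \<notin> S" "z \<in> set v" for i z
    using that by (auto simp: S_def nonisolated_def k_def in_set_conv_nth)
  have P_iff: "P (v ! i)" if "i \<in> S" "\<sigma> (neighbour v i) < k - x" for i
  proof -
    let ?j = "neighbour v i"
    have j: "?j < k" "adj (v ! i) (v ! ?j)" using neighbour[of i v] that by (auto simp: S_def k_def)
    have "w ! \<sigma> ?j \<in> set as" unfolding as_def
      using that lw by (auto simp: in_set_conv_nth intro!: exI[of _ "\<sigma> ?j"])
    thus ?thesis using nth[OF j(1)] adj_sym[OF j(2)] by (auto simp: P_def touches_def)
  qed
  have lfd: "length (filter Q (drop d w)) = card {i. i < k \<and> d \<le> \<sigma> i \<and> Q (v ! i)}" for Q d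
    unfolding w_def k_def by (rule length_filter_drop_permute_list[OF \<sigma>'])
  have notP: "\<not> P (v ! i)" if "i < k" "i \<notin> S" for i
  proof
    assume "P (v ! i)"
    then obtain a where a: "a \<in> set as" "adj a (v ! i)" by (auto simp: P_def touches_def)
    hence "a \<in> set v" using set_take_subset[of "k - x" w] mset_eq_setD[OF mw] by (auto simp: as_def)
    thus False using iso[OF that] a(2) adj_sym by blast
  qed
  have c1: "cross (as @ us @ ws) (as @ us @ ws) = L"
  proof -
    have "mset (as @ us @ ws) = mset (as @ bs)" by (simp add: us_def ws_def)
    hence "mset (as @ us @ ws) = mset v" using mw by (simp add: as_def bs_def del: mset_append)
    thus ?thesis using cross_cong_mset L by metis
  qed
  have c2: "M \<le> length us"
  proof -
    define X where "X = {i \<in> S. \<sigma> i \<in> {k - x..<k}}"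
    define Y where "Y = {i \<in> S. \<sigma> i \<in> {k - x..<k} \<and> \<sigma> (neighbour v i) \<in> {k - x..<k}}"
    have YX: "Y \<subseteq> X" "finite X" using finS by (auto simp: X_def Y_def)
    have "X - Y \<subseteq> {i. i < k \<and> k - x \<le> \<sigma> i \<and> P (v ! i)}"
    proof
      fix i assume i: "i \<in> X - Y"
      have "neighbour v i < k" using i neighbour[of i v] by (auto simp: X_def S_def k_def)
      hence "\<sigma> (neighbour v i) < k - x" using i lt[of "neighbour v i"] by (auto simp: X_def Y_def)
      thus "i \<in> {i. i < k \<and> k - x \<le> \<sigma> i \<and> P (v ! i)}" using i P_iff Sk by (auto simp: X_def)
    qed
    hence "card (X - Y) \<le> length us" unfolding us_def bs_def lfd by (rule card_mono[rotated]) simp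
    moreover have "card (X - Y) = card X - card Y" "card Y \<le> card X"
      using YX by (auto simp: card_Diff_subset finite_subset card_mono)
    ultimately have "real (card X) \<le> length us + real (card Y)" by linarith
    thus ?thesis using M by (simp add: X_def Y_def)
  qed
  have c3: "M' \<le> length ws"
  proof -
    have "card {i \<in> {..<k} - S. \<sigma> i \<in> {k - x..<k}} \<le> length ws" unfolding ws_def bs_def lfd
      by (rule card_mono) (use notP in auto)
    thus ?thesis using M' by linarith
  qed
  \<comment> \<open>\<open>ws2\<close> collects the non-touching entries of the last
    \<open>y\<close> places, and \<open>t2\<close> below consists of its last \<open>T\<close>
    entries, which are also the last \<open>T\<close> of \<open>ws\<close>.\<close>
  define ws1 where "ws1 = filter (\<lambda>v. \<not> P v) (take (x - y) bs)"
  define ws2 where "ws2 = filter (\<lambda>v. \<not> P v) (drop (k - y) w)"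
  have "drop (k - y) w = drop (x - y) bs" using yx by (simp add: bs_def)
  hence ws: "ws = ws1 @ ws2" unfolding ws_def ws1_def ws2_def
    by (metis append_take_drop_id filter_append)
  have T2: "T \<le> length ws2"
  proof -
    have "card {i \<in> {..<k} - S. \<sigma> i \<in> {k - y..<k}} \<le> length ws2" unfolding ws2_def lfd
      by (rule card_mono) (use notP in auto)
    thus ?thesis using T by simp
  qed
  define t1 where "t1 = take (length ws2 - T) ws2"
  define t2 where "t2 = drop (length ws2 - T) ws2"
  have "length ws - T = length ws1 + (length ws2 - T)" using T2 by (simp add: ws)
  hence tk: "take (length ws - T) ws = ws1 @ t1" unfolding ws t1_def by simp
  \<comment> \<open>Were such an entry non-isolated, its neighbour would have to lie in the last
    \<open>x\<close> places, against \<open>no\<close>. Hence deleting \<open>t2\<close> loses no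
    edge.\<close>
  have dead: "\<not> adj z z'" if "z \<in> set t2" "z' \<in> set v" for z z'
  proof -
    have "z \<in> set (drop (k - y) w)" "\<not> P z"
      using that(1) set_drop_subset[of "length ws2 - T" ws2] by (auto simp: t2_def ws2_def)
    then obtain r where r: "r < y" "z = w ! (k - y + r)" "k - y + r < k"
      using yx lw by (auto simp: in_set_conv_nth)
    define i where "i = inv \<sigma> (k - y + r)"
    have si: "\<sigma> i = k - y + r" using permutes_inverses(1)[OF \<sigma>] by (simp add: i_def)
    have i: "i < k" using lt[of i] si r by simp
    have z: "z = v ! i" using nth[OF i] si r by simp
    have "i \<notin> S"
    proof
      assume iS: "i \<in> S"
      have "\<not> \<sigma> (neighbour v i) < k - x" using P_iff[OF iS] \<open>\<not> P z\<close> z by auto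
      moreover have "\<sigma> (neighbour v i) < k" using lt neighbour[of i v] iS by (auto simp: S_def k_def)
      ultimately show False using no[OF iS] si r by auto
    qed
    thus ?thesis using iso[OF i _ that(2)] z by simp
  qed
  have sub: "set (as @ us @ ws) \<subseteq> set v"
    using mset_eq_setD[OF mw] set_take_subset[of "k - x" w] set_drop_subset[of "k - x" w]
    by (auto simp: as_def us_def ws_def bs_def)
  have t12: "ws = ws1 @ t1 @ t2" by (simp add: ws t1_def t2_def)
  have c4: "cross (as @ us @ ws1 @ t1) (as @ us @ ws1 @ t1) = L"
  proof -
    have "cross (as @ us @ ws1 @ t1) t2 = 0" unfolding cross_commute[of _ t2]
      by (rule cross_eq_0) (use dead sub in \<open>auto simp: t12\<close>)
    moreover have "cross t2 t2 = 0" by (rule cross_eq_0) (use dead sub in \<open>auto simp: t12\<close>)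
    moreover have "as @ us @ ws = (as @ us @ ws1 @ t1) @ t2" by (simp add: t12)
    ultimately show ?thesis using c1 cross_self_append[of "as @ us @ ws1 @ t1" t2] by simp
  qed
  have "stable_part L M M' T as us ws"
    unfolding stable_part_def Let_def tk using c1 c2 c3 c4 T2 by (simp add: ws)
  thus ?thesis unfolding stable_split_def us_def ws_def P_def as_def bs_def w_def .
qed

text \<open>A union bound over five bad events, one for each subtracted term, outside of which the
  deterministic criterion applies.\<close>

lemma card_stable_permutations:
  fixes v :: "'a list" and m0 m1 \<epsilon> :: real and x y T :: nat
  defines "k \<equiv> length v" and "m \<equiv> real (card (nonisolated v))"
  assumes yx: "0 < y" "y \<le> x" "x \<le> k" and L: "cross v v = L" and \<epsilon>: "0 < \<epsilon>"
    and m: "0 < m0" "m0 \<le> m" "m \<le> m1" "m \<le> (1 - \<epsilon>) * k" and T: "T \<le> \<epsilon> * y / 2"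
  shows "fact k * (1 - 4 * k / (x * m0) - 4 * x / k - 4 / (\<epsilon> * x) - 4 / (\<epsilon> * y) - m1 * y * x / k\<^sup>2) \<le>
    card {\<sigma>. \<sigma> permutes {..<k} \<and> stable_split L (x * m0 / (4 * k)) (\<epsilon> * x / 2) T
      (take (k - x) (permute_list (inv \<sigma>) v)) (drop (k - x) (permute_list (inv \<sigma>) v))}"
proof -
  define S where "S = nonisolated v"
  define I where "I = {..<k} - S"
  define A2 where "A2 = {k - x..<k}"
  define A3 where "A3 = {k - y..<k}"
  define \<Omega> where "\<Omega> = {\<sigma>. \<sigma> permutes {..<k}}"
  define F :: real where "F = fact k"
  define nb where "nb = neighbour v"
  define G where "G = {\<sigma> \<in> \<Omega>. stable_split L (x * m0 / (4 * k)) (\<epsilon> * x / 2) T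
      (take (k - x) (permute_list (inv \<sigma>) v)) (drop (k - x) (permute_list (inv \<sigma>) v))}"
  have k0: "0 < k" "0 < x" using yx by auto
  have F0: "0 < F" by (simp add: F_def)
  have fin: "finite \<Omega>" unfolding \<Omega>_def by (rule finite_permutations) simp
  have c\<Omega>: "real (card \<Omega>) = F" by (simp add: \<Omega>_def F_def card_permutations)
  have SI: "S \<subseteq> {..<k}" "I \<subseteq> {..<k}" by (auto simp: S_def I_def nonisolated_def k_def)
  have finS: "finite S" by (simp add: S_def)
  have cA: "card A2 = x" "card A3 = y" using yx by (auto simp: A2_def A3_def)
  have A: "A3 \<subseteq> A2" "A2 \<subseteq> {..<k}" "A3 \<subseteq> {..<k}" using yx by (auto simp: A2_def A3_def)
  have cS: "real (card S) = m" by (simp add: S_def m_def)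
  have m_pos: "0 < m" using m by simp
  have cI: "real (card I) = k - m"
  proof -
    have "card I = k - card S" unfolding I_def using card_Diff_subset[OF finS SI(1)] by simp
    moreover have "card S \<le> k" using card_mono[OF _ SI(1)] by simp
    ultimately show ?thesis using cS by (simp add: of_nat_diff)
  qed
  have I_ge: "\<epsilon> * k \<le> card I" using m cI by (simp add: algebra_simps)
  define \<mu> where "\<mu> = m * x / k"
  have \<mu>0: "0 < \<mu>" using m_pos k0 by (simp add: \<mu>_def)
  have \<mu>_ge: "x * m0 / k \<le> \<mu>" using m k0 by (simp add: \<mu>_def divide_right_mono mult.commute)

  \<comment> \<open>Outside \<open>B1\<close> more than \<open>\<mu> / 2\<close> non-isolated
    entries land in the last \<open>x\<close> places; outside \<open>B2\<close> fewer than
    \<open>\<mu> / 4\<close> of them are spoilt by their neighbours. The remaining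
    \<open>\<mu> / 4\<close> is at least \<open>x * m0 / (4 * k)\<close>.\<close>
  define B1 where "B1 = {\<sigma> \<in> \<Omega>. card {i \<in> S. \<sigma> i \<in> A2} \<le> \<mu> / 2}"
  have B1: "real (card B1) \<le> F * (4 * k / (x * m0))"
  proof -
    have "real (card B1) \<le> F * (4 / \<mu>)"
      using card_permutes_few_hits[OF _ SI(1) A(2), of \<mu>] \<mu>0 cA cS
      by (simp add: B1_def \<Omega>_def F_def \<mu>_def)
    also have "\<dots> \<le> F * (4 / (x * m0 / k))"
      by (intro mult_left_mono divide_left_mono \<mu>_ge) (use F0 \<mu>0 m k0 in auto)
    finally show ?thesis by (simp add: mult.commute)
  qed

  have pair: "real (card {\<sigma> \<in> \<Omega>. \<sigma> i \<in> B \<and> \<sigma> (nb i) \<in> A2}) \<le> F * card B * x / k\<^sup>2"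
    if "i \<in> S" "B \<subseteq> A2" for i B
    using card_permutes_two_points_in[of "{..<k}" i "nb i" B A2] neighbour[of i v] that A SI cA
    by (auto simp: \<Omega>_def F_def nb_def S_def k_def)

  \<comment> \<open>The mean of \<open>h\<close> is at most \<open>m (x/k)^2\<close>, and Markov's
    inequality at \<open>\<mu> / 4 = m x / (4 k)\<close> yields \<open>4 x / k\<close>.\<close>
  define h where "h = (\<lambda>\<sigma>. card {i \<in> S. \<sigma> i \<in> A2 \<and> \<sigma> (nb i) \<in> A2})"
  define B2 where "B2 = {\<sigma> \<in> \<Omega>. \<mu> / 4 \<le> h \<sigma>}"
  have B2: "real (card B2) \<le> F * (4 * x / k)"
  proof -
    have "real (card B2) \<le> (\<Sum>\<sigma>\<in>\<Omega>. real (h \<sigma>)) / (\<mu> / 4)"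
      unfolding B2_def by (rule card_markov[OF fin]) (use \<mu>0 in auto)
    also have "(\<Sum>\<sigma>\<in>\<Omega>. real (h \<sigma>)) = (\<Sum>\<sigma>\<in>\<Omega>. \<Sum>i\<in>S. of_bool (\<sigma> i \<in> A2 \<and> \<sigma> (nb i) \<in> A2))"
      using finS by (simp add: h_def of_bool_def sum.If_cases Int_def)
    also have "\<dots> = (\<Sum>i\<in>S. \<Sum>\<sigma>\<in>\<Omega>. of_bool (\<sigma> i \<in> A2 \<and> \<sigma> (nb i) \<in> A2))" by (rule sum.swap)
    also have "\<dots> = (\<Sum>i\<in>S. real (card {\<sigma> \<in> \<Omega>. \<sigma> i \<in> A2 \<and> \<sigma> (nb i) \<in> A2}))"
      using fin by (simp add: of_bool_def sum.If_cases Int_def)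
    also have "\<dots> \<le> (\<Sum>i\<in>S. F * card A2 * x / k\<^sup>2)" by (intro sum_mono pair) auto
    also have "\<dots> = m * (F * x * x / k\<^sup>2)" by (simp add: cS cA)
    finally have "real (card B2) \<le> m * (F * x * x / k\<^sup>2) / (\<mu> / 4)"
      using \<mu>0 by (simp add: divide_right_mono)
    also have "\<dots> = F * (4 * x / k)" using m_pos k0 by (simp add: \<mu>_def field_simps power2_eq_square)
    finally show ?thesis .
  qed

  \<comment> \<open>At least \<open>\<epsilon> k\<close> positions are isolated, so a window of
    \<open>z\<close> places receives at least \<open>\<epsilon> z\<close> of them on
    average.\<close>
  have few: "real (card {\<sigma> \<in> \<Omega>. card {i \<in> I. \<sigma> i \<in> A} \<le> \<epsilon> * z / 2}) \<le> F * (4 / (\<epsilon> * z))"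
    if z: "0 < z" "card A = z" "A \<subseteq> {..<k}" for A and z :: nat
  proof -
    define \<nu> where "\<nu> = card I * card A / k"
    have "\<epsilon> * k * z / k \<le> real (card I) * z / k"
      by (intro divide_right_mono mult_right_mono I_ge) auto
    hence \<nu>: "\<epsilon> * z \<le> \<nu>" using k0 z by (simp add: \<nu>_def)
    moreover have ez: "0 < \<epsilon> * z" using \<epsilon> z by simp
    ultimately have \<nu>0: "0 < \<nu>" by linarith
    have "card {\<sigma> \<in> \<Omega>. card {i \<in> I. \<sigma> i \<in> A} \<le> \<epsilon> * z / 2} \<le> card {\<sigma> \<in> \<Omega>. card {i \<in> I. \<sigma> i \<in> A} \<le> \<nu> / 2}"
      by (rule card_mono) (use fin \<nu> in auto)
    also have "real \<dots> \<le> F * (4 / \<nu>)"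
      using card_permutes_few_hits[OF _ SI(2) z(3), of \<nu>] \<nu>0 by (simp add: \<Omega>_def F_def \<nu>_def)
    also have "\<dots> \<le> F * (4 / (\<epsilon> * z))"
      by (intro mult_left_mono divide_left_mono \<nu>) (use F0 ez \<nu>0 in auto)
    finally show ?thesis by simp
  qed
  define B3 where "B3 = {\<sigma> \<in> \<Omega>. card {i \<in> I. \<sigma> i \<in> A2} \<le> \<epsilon> * x / 2}"
  have B3: "real (card B3) \<le> F * (4 / (\<epsilon> * x))" unfolding B3_def by (rule few) (use k0 cA A in auto)
  define B4 where "B4 = {\<sigma> \<in> \<Omega>. card {i \<in> I. \<sigma> i \<in> A3} \<le> \<epsilon> * y / 2}"
  have B4: "real (card B4) \<le> F * (4 / (\<epsilon> * y))" unfolding B4_def by (rule few) (use yx cA A in auto)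

  \<comment> \<open>A first-moment bound: at most \<open>m1\<close> positions, each contributing
    \<open>(y/k) (x/k)\<close>.\<close>
  define B5 where "B5 = {\<sigma> \<in> \<Omega>. \<exists>i\<in>S. \<sigma> i \<in> A3 \<and> \<sigma> (nb i) \<in> A2}"
  have B5: "real (card B5) \<le> F * (m1 * y * x / k\<^sup>2)"
  proof -
    have "B5 = (\<Union>i\<in>S. {\<sigma> \<in> \<Omega>. \<sigma> i \<in> A3 \<and> \<sigma> (nb i) \<in> A2})" by (auto simp: B5_def)
    hence "card B5 \<le> (\<Sum>i\<in>S. card {\<sigma> \<in> \<Omega>. \<sigma> i \<in> A3 \<and> \<sigma> (nb i) \<in> A2})"
      using card_UN_le[OF finS] by simp
    hence "real (card B5) \<le> (\<Sum>i\<in>S. real (card {\<sigma> \<in> \<Omega>. \<sigma> i \<in> A3 \<and> \<sigma> (nb i) \<in> A2}))"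
      unfolding of_nat_sum[symmetric] of_nat_le_iff .
    also have "\<dots> \<le> (\<Sum>i\<in>S. F * card A3 * x / k\<^sup>2)" by (intro sum_mono pair A)
    also have "\<dots> = m * (F * y * x / k\<^sup>2)" by (simp add: cS cA)
    also have "\<dots> \<le> m1 * (F * y * x / k\<^sup>2)" by (rule mult_right_mono) (use m F0 in auto)
    finally show ?thesis by (simp add: mult_ac)
  qed

  have cover: "\<Omega> \<subseteq> G \<union> B1 \<union> B2 \<union> B3 \<union> B4 \<union> B5"
  proof
    fix \<sigma> assume \<sigma>: "\<sigma> \<in> \<Omega>"
    show "\<sigma> \<in> G \<union> B1 \<union> B2 \<union> B3 \<union> B4 \<union> B5"
    proof (rule ccontr)
      assume no: "\<sigma> \<notin> G \<union> B1 \<union> B2 \<union> B3 \<union> B4 \<union> B5"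
      have "stable_split L (x * m0 / (4 * k)) (\<epsilon> * x / 2) T
        (take (k - x) (permute_list (inv \<sigma>) v)) (drop (k - x) (permute_list (inv \<sigma>) v))"
        unfolding k_def
      proof (rule stable_split_permute_list)
        have "real (card {i \<in> S. \<sigma> i \<in> A2}) > \<mu> / 2" "h \<sigma> < \<mu> / 4" using no \<sigma> by (auto simp: B1_def B2_def)
        hence "x * m0 / (4 * k) + real (h \<sigma>) \<le> real (card {i \<in> S. \<sigma> i \<in> A2})"
          using \<mu>_ge by (simp add: field_simps)
        thus "real x * m0 / real (4 * length v) +
          real (card {i \<in> nonisolated v. \<sigma> i \<in> {length v - x..<length v} \<and> \<sigma> (neighbour v i) \<in> {length v - x..<length v}})
          \<le> real (card {i \<in> nonisolated v. \<sigma> i \<in> {length v - x..<length v}})"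
          by (simp add: h_def S_def A2_def k_def nb_def)
        have "\<epsilon> * x / 2 < card {i \<in> I. \<sigma> i \<in> A2}" using no \<sigma> by (auto simp: B3_def)
        thus "\<epsilon> * real x / 2 \<le> real (card {i \<in> {..<length v} - nonisolated v. \<sigma> i \<in> {length v - x..<length v}})"
          by (simp add: I_def S_def A2_def k_def)
        have "\<epsilon> * y / 2 < card {i \<in> I. \<sigma> i \<in> A3}" using no \<sigma> by (auto simp: B4_def)
        hence "T \<le> card {i \<in> I. \<sigma> i \<in> A3}" using T by linarith
        thus "T \<le> card {i \<in> {..<length v} - nonisolated v. \<sigma> i \<in> {length v - y..<length v}}"
          by (simp add: I_def S_def A3_def k_def)
      qed (use \<sigma> no yx L in \<open>auto simp: \<Omega>_def B5_def S_def A2_def A3_def nb_def k_def\<close>)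
      thus False using no \<sigma> by (simp add: G_def)
    qed
  qed
  have "card \<Omega> \<le> card (G \<union> B1 \<union> B2 \<union> B3 \<union> B4 \<union> B5)"
    by (rule card_mono[OF _ cover]) (use fin in \<open>auto simp: G_def B1_def B2_def B3_def B4_def B5_def\<close>)
  also have "\<dots> \<le> card G + card B1 + card B2 + card B3 + card B4 + card B5"
    by (intro order_trans[OF card_Un_le] add_mono order_refl)
  finally have "F \<le> card G + real (card B1) + card B2 + card B3 + card B4 + card B5"
    unfolding c\<Omega>[symmetric] by linarith
  hence "F - F * (4 * k / (x * m0)) - F * (4 * x / k) - F * (4 / (\<epsilon> * x)) - F * (4 / (\<epsilon> * y)) - F * (m1 * y * x / k\<^sup>2) \<le> card G"
    using B1 B2 B3 B4 B5 by linarith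
  thus ?thesis by (simp add: G_def \<Omega>_def F_def right_diff_distrib)
qed

text \<open>Double counting of pairs of a sequence and a permutation: each sequence considered has
  at least \<open>c k!\<close> stable rearrangements, while each permutation maps sequences
  injectively into the set \<open>W\<close> of stable ones. Fixing the first \<open>k - x\<close>
  entries bounds \<open>W\<close>.\<close>

lemma card_lists_with_degree_sum_le:
  fixes c m0 m1 \<epsilon> :: real and x y T k :: nat
  defines "c \<equiv> 1 - 4 * k / (x * m0) - 4 * x / k - 4 / (\<epsilon> * x) - 4 / (\<epsilon> * y) - m1 * y * x / k\<^sup>2"
  assumes V: "finite V" and yx: "0 < y" "y \<le> x" "x \<le> k" and \<epsilon>: "0 < \<epsilon>"
    and m: "0 < m0" "m1 \<le> (1 - \<epsilon>) * k" and T: "1 \<le> T" "T \<le> \<epsilon> * y / 2"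
  shows "c * card {v \<in> lists_of V k. cross v v = L \<and> m0 \<le> card (nonisolated v) \<and> card (nonisolated v) \<le> m1} \<le>
    real (card V) ^ k * (2 * sqrt (8 * k / (\<epsilon> * x * m0)) + 1 / T)"
proof -
  define G where "G = {v \<in> lists_of V k. cross v v = L \<and> m0 \<le> card (nonisolated v) \<and> card (nonisolated v) \<le> m1}"
  define Q where "Q = (\<lambda>w. stable_split L (x * m0 / (4 * k)) (\<epsilon> * x / 2) T (take (k - x) w) (drop (k - x) w))"
  define \<Omega> where "\<Omega> = {\<sigma>. \<sigma> permutes {..<k}}"
  define W where "W = {w \<in> lists_of V k. Q w}"
  define b where "b = 2 * sqrt (8 * k / (\<epsilon> * x * m0)) + 1 / T"
  have k0: "0 < k" "0 < x" using yx by auto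
  have fin\<Omega>: "finite \<Omega>" unfolding \<Omega>_def by (rule finite_permutations) simp
  have c\<Omega>: "card \<Omega> = fact k" by (simp add: \<Omega>_def card_permutations)
  have finL: "finite (lists_of V n)" for n by (rule finite_lists_of[OF V])
  have finG: "finite G" unfolding G_def using finL by simp
  have W_le: "real (card W) \<le> real (card V) ^ k * b"
  proof -
    have "W \<subseteq> (\<Union>as\<in>lists_of V (k - x). (@) as ` {bs \<in> lists_of V x. stable_split L (x * m0 / (4 * k)) (\<epsilon> * x / 2) T as bs})"
    proof
      fix w assume w: "w \<in> W"
      let ?a = "take (k - x) w" and ?b = "drop (k - x) w"
      have "?a \<in> lists_of V (k - x)" "?b \<in> lists_of V x"
        using w yx by (auto simp: W_def lists_of_def dest: in_set_takeD in_set_dropD)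
      moreover have "w = ?a @ ?b" by simp
      ultimately show "w \<in> (\<Union>as\<in>lists_of V (k - x). (@) as ` {bs \<in> lists_of V x. stable_split L (x * m0 / (4 * k)) (\<epsilon> * x / 2) T as bs})"
        using w by (intro UN_I[of ?a] image_eqI[of _ _ ?b]) (auto simp: W_def Q_def)
    qed
    hence "card W \<le> card (\<Union>as\<in>lists_of V (k - x). (@) as ` {bs \<in> lists_of V x. stable_split L (x * m0 / (4 * k)) (\<epsilon> * x / 2) T as bs})"
      by (rule card_mono[rotated]) (use finL in auto)
    also have "\<dots> \<le> (\<Sum>as\<in>lists_of V (k - x). card ((@) as ` {bs \<in> lists_of V x. stable_split L (x * m0 / (4 * k)) (\<epsilon> * x / 2) T as bs}))"
      by (rule card_UN_le[OF finL])
    also have "\<dots> \<le> (\<Sum>as\<in>lists_of V (k - x). card {bs \<in> lists_of V x. stable_split L (x * m0 / (4 * k)) (\<epsilon> * x / 2) T as bs})"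
      by (intro sum_mono card_image_le) (use finL in auto)
    finally have "real (card W) \<le> (\<Sum>as\<in>lists_of V (k - x). real (card {bs \<in> lists_of V x. stable_split L (x * m0 / (4 * k)) (\<epsilon> * x / 2) T as bs}))"
      unfolding of_nat_sum[symmetric] of_nat_le_iff .
    also have "\<dots> \<le> (\<Sum>as\<in>lists_of V (k - x). real (card V) ^ x * (2 * sqrt (x / (x * m0 / (4 * k) * (\<epsilon> * x / 2))) + 1 / T))"
      by (rule sum_mono, rule card_stable_split_le[OF V _ _ T(1)]) (use k0 m(1) \<epsilon> in simp_all)
    also have "x / (x * m0 / (4 * k) * (\<epsilon> * x / 2)) = 8 * k / (\<epsilon> * x * m0)"
      using k0 m \<epsilon> by (simp add: field_simps)
    also have "(\<Sum>as\<in>lists_of V (k - x). real (card V) ^ x * (2 * sqrt (8 * k / (\<epsilon> * x * m0)) + 1 / T)) =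
        (real (card V) ^ (k - x) * real (card V) ^ x) * b"
      using V by (simp add: card_lists_of b_def)
    also have "real (card V) ^ (k - x) * real (card V) ^ x = real (card V) ^ k"
      using yx by (simp flip: power_add)
    finally show ?thesis .
  qed
  have "fact k * c * card G = (\<Sum>v\<in>G. fact k * c)" by simp
  also have "\<dots> \<le> (\<Sum>v\<in>G. real (card {\<sigma> \<in> \<Omega>. Q (permute_list (inv \<sigma>) v)}))"
  proof (rule sum_mono)
    fix v assume v: "v \<in> G"
    hence len: "length v = k" by (simp add: G_def lists_of_def)
    show "fact k * c \<le> real (card {\<sigma> \<in> \<Omega>. Q (permute_list (inv \<sigma>) v)})"
      using card_stable_permutations[of y x v L \<epsilon> m0 m1 T] yx \<epsilon> m T v
      unfolding len c_def \<Omega>_def Q_def by (auto simp: G_def)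
  qed
  also have "\<dots> = real (\<Sum>v\<in>G. card {\<sigma> \<in> \<Omega>. Q (permute_list (inv \<sigma>) v)})" by simp
  also have "(\<Sum>v\<in>G. card {\<sigma> \<in> \<Omega>. Q (permute_list (inv \<sigma>) v)}) = (\<Sum>\<sigma>\<in>\<Omega>. card {v \<in> G. Q (permute_list (inv \<sigma>) v)})"
    by (rule sum_multicount_gen[OF finG fin\<Omega>]) simp
  also have "\<dots> \<le> (\<Sum>\<sigma>\<in>\<Omega>. card W)"
  proof (rule sum_mono)
    fix \<sigma> assume \<sigma>: "\<sigma> \<in> \<Omega>"
    show "card {v \<in> G. Q (permute_list (inv \<sigma>) v)} \<le> card W"
    proof (rule card_inj_on_le)
      have perm: "\<sigma> permutes {..<k}" using \<sigma> by (simp add: \<Omega>_def)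
      show "inj_on (permute_list (inv \<sigma>)) {v \<in> G. Q (permute_list (inv \<sigma>) v)}"
      proof (rule inj_onI)
        fix u v assume uv: "u \<in> {v \<in> G. Q (permute_list (inv \<sigma>) v)}" "v \<in> {v \<in> G. Q (permute_list (inv \<sigma>) v)}"
          "permute_list (inv \<sigma>) u = permute_list (inv \<sigma>) v"
        hence len: "length u = k" "length v = k" by (auto simp: G_def lists_of_def)
        show "u = v"
        proof (rule nth_equalityI)
          fix i assume i: "i < length u"
          have "u ! i = permute_list (inv \<sigma>) u ! \<sigma> i" by (rule nth_permute_list_inv[symmetric]) (use perm i len in auto)
          also have "\<dots> = v ! i" unfolding uv(3) by (rule nth_permute_list_inv) (use perm i len in auto)
          finally show "u ! i = v ! i" .
        qed (simp add: len)
      qed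
      show "permute_list (inv \<sigma>) ` {v \<in> G. Q (permute_list (inv \<sigma>) v)} \<subseteq> W"
      proof safe
        fix v assume v: "v \<in> G" "Q (permute_list (inv \<sigma>) v)"
        hence "length v = k" "set v \<subseteq> V" by (auto simp: G_def lists_of_def)
        moreover from this have "set (permute_list (inv \<sigma>) v) = set v"
          using permutes_inv[OF perm] by (simp add: set_permute_list)
        ultimately show "permute_list (inv \<sigma>) v \<in> W" using v by (simp add: W_def lists_of_def)
      qed
      show "finite W" unfolding W_def using finL by simp
    qed
  qed
  finally have "fact k * c * card G \<le> fact k * real (card W)"
    by (simp add: c\<Omega>)
  hence "c * card G \<le> card W" by (simp add: mult.assoc)
  thus ?thesis using W_le unfolding G_def b_def by linarith
qed

end

section \<open>From sequences to subsets\<close>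

lemma adjacency_graphs_on:
  assumes "E \<in> graphs_on V"
  shows "adjacency (\<lambda>x y. {x, y} \<in> E)"
proof
  fix x y :: 'a
  show "{x, y} \<in> E \<Longrightarrow> {y, x} \<in> E" by (simp add: insert_commute)
  have "card {x, x} \<noteq> 2" by simp
  thus "{x, x} \<notin> E" using assms unfolding graphs_on_def ksubsets_def by blast
qed

text \<open>Distinct entries turn pairs of positions into ordered pairs of vertices, and each edge
  gives two of these.\<close>

lemma cross_eq_edges_spanned:
  assumes E: "E \<in> graphs_on V" and v: "distinct v"
  shows "adjacency.cross (\<lambda>x y. {x, y} \<in> E) v v = 2 * edges_spanned E (set v)"
proof -
  interpret adjacency "\<lambda>x y. {x, y} \<in> E" using E by (rule adjacency_graphs_on)
  let ?S = "set v"
  define X where "X = E \<inter> ksubsets ?S 2"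
  have finX: "finite X" by (simp add: X_def finite_ksubsets)
  have two: "card {p. {fst p, snd p} = e} = 2" if "e \<in> X" for e
  proof -
    have "card e = 2" using that by (simp add: X_def ksubsets_def)
    then obtain a b where ab: "e = {a, b}" "a \<noteq> b" by (auto simp: card_2_iff)
    have "{p. {fst p, snd p} = e} = {(a, b), (b, a)}"
      using ab(2) by (auto simp: ab(1) doubleton_eq_iff)
    thus ?thesis using ab(2) by simp
  qed
  have "cross v v = (\<Sum>x\<in>?S. \<Sum>y\<in>?S. of_bool ({x, y} \<in> E))"
    using v by (simp add: cross_def sum_list_distinct_conv_sum_set)
  also have "\<dots> = (\<Sum>p\<in>?S \<times> ?S. of_bool ({fst p, snd p} \<in> E))"
    unfolding sum.cartesian_product case_prod_unfold ..
  also have "\<dots> = card {p \<in> ?S \<times> ?S. {fst p, snd p} \<in> E}"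
    by (simp add: of_bool_def sum.If_cases Int_def)
  also have "{p \<in> ?S \<times> ?S. {fst p, snd p} \<in> E} = (\<Union>e\<in>X. {p. {fst p, snd p} = e})"
  proof (intro equalityI subsetI)
    fix p assume p: "p \<in> {p \<in> ?S \<times> ?S. {fst p, snd p} \<in> E}"
    hence "{fst p, snd p} \<in> X" using E by (auto simp: X_def ksubsets_def graphs_on_def)
    thus "p \<in> (\<Union>e\<in>X. {p. {fst p, snd p} = e})" by blast
  next
    fix p assume "p \<in> (\<Union>e\<in>X. {p. {fst p, snd p} = e})"
    hence "{fst p, snd p} \<in> X" by blast
    thus "p \<in> {p \<in> ?S \<times> ?S. {fst p, snd p} \<in> E}" by (cases p) (auto simp: X_def ksubsets_def)
  qed
  also have "card \<dots> = (\<Sum>e\<in>X. card {p. {fst p, snd p} = e})"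
  proof (rule card_UN_disjoint[OF finX])
    show "\<forall>e\<in>X. finite {p. {fst p, snd p} = e}" using two by (metis card.infinite zero_neq_numeral)
  qed auto
  also have "\<dots> = 2 * card X" using two by simp
  finally show ?thesis by (simp add: X_def edges_spanned_def)
qed

text \<open>Almost all sequences of length \<open>k\<close> are injective once \<open>n\<close> is
  large.\<close>

lemma power_over_falling_factorial_tendsto:
  "(\<lambda>n. real n ^ k / (fact k * (n choose k))) \<longlonglongrightarrow> 1"
proof -
  have "(\<lambda>n. \<Prod>i<k. 1 - real i / real n) \<longlonglongrightarrow> (\<Prod>i<k. 1 - 0)"
    by (intro tendsto_prod tendsto_diff tendsto_const lim_const_over_n)
  hence "(\<lambda>n. inverse (\<Prod>i<k. 1 - real i / real n)) \<longlonglongrightarrow> inverse 1"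
    by (intro tendsto_inverse) auto
  moreover have "\<forall>\<^sub>F n in sequentially. inverse (\<Prod>i<k. 1 - real i / real n) = real n ^ k / (fact k * (n choose k))"
  proof (rule eventually_sequentiallyI[of 1])
    fix n :: nat assume n: "1 \<le> n"
    have "(\<Prod>i<k. 1 - real i / real n) = (\<Prod>i<k. (real n - real i) / real n)"
      using n by (intro prod.cong) (auto simp: field_simps)
    also have "\<dots> = (\<Prod>i<k. real n - real i) / real n ^ k" by (simp add: prod_dividef)
    also have "(\<Prod>i<k. real n - real i) = fact k * (n choose k)"
      by (simp add: binomial_gbinomial gbinomial_prod_rev atLeast0LessThan)
    finally show "inverse (\<Prod>i<k. 1 - real i / real n) = real n ^ k / (fact k * (n choose k))" by simp
  qed
  ultimately show ?thesis by (simp add: tendsto_cong)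
qed

lemma max_ind_leI:
  assumes "\<And>E. E \<in> graphs_on {..<n} \<Longrightarrow>
    measure_pmf.prob (pmf_of_set (ksubsets {..<n} k)) {S. edges_spanned E S = l} \<le> B"
  shows "max_ind n k l \<le> B"
proof -
  have "{} \<in> graphs_on {..<n}" by (simp add: graphs_on_def)
  thus ?thesis unfolding max_ind_def
    by (intro Max.boundedI finite_imageI finite_graphs_on) (use assms in auto)
qed

text \<open>Settles the small values of \<open>l\<close>, for which the claimed bound exceeds
  1.\<close>

lemma ind_le_1: "ind k l \<le> 1"
  by (rule LIMSEQ_le_const2[OF max_ind_tendsto_ind])
     (auto intro!: max_ind_leI measure_pmf.prob_le_1)

text \<open>Every good \<open>k\<close>-set is enumerated by \<open>k!\<close> good sequences, and
  sequences with repetitions only enlarge the count. The change of normalisation disappears in the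
  limit.\<close>

lemma ind_leI:
  assumes le: "\<And>n E. E \<in> graphs_on {..<n} \<Longrightarrow>
      card {v \<in> lists_of {..<n} k. adjacency.cross (\<lambda>x y. {x, y} \<in> E) v v = 2 * l} \<le> B * real n ^ k"
  shows "ind k l \<le> B"
proof (rule LIMSEQ_le[OF max_ind_tendsto_ind])
  show "(\<lambda>n. B * (real n ^ k / (fact k * (n choose k)))) \<longlonglongrightarrow> B"
    using tendsto_mult_left[OF power_over_falling_factorial_tendsto, of B k] by simp
  have "max_ind n k l \<le> B * (real n ^ k / (fact k * (n choose k)))" if n: "k \<le> n" for n
  proof (rule max_ind_leI)
    fix E assume E: "E \<in> graphs_on {..<n}"
    define \<S> where "\<S> = {S \<in> ksubsets {..<n} k. edges_spanned E S = l}"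
    define G where "G = {v \<in> lists_of {..<n} k. adjacency.cross (\<lambda>x y. {x, y} \<in> E) v v = 2 * l}"
    have fin\<S>: "finite \<S>" by (simp add: \<S>_def finite_ksubsets)
    have "card \<S> * fact k = (\<Sum>S\<in>\<S>. card (permutations_of_set S))"
      by (simp add: \<S>_def ksubsets_def)
    also have "\<dots> = card (\<Union>S\<in>\<S>. permutations_of_set S)"
      by (rule card_UN_disjoint[symmetric]) (use fin\<S> in \<open>auto dest: permutations_of_setD\<close>)
    also have "\<dots> \<le> card G"
    proof (rule card_mono)
      show "finite G" by (simp add: G_def finite_lists_of)
      show "(\<Union>S\<in>\<S>. permutations_of_set S) \<subseteq> G"
      proof safe
        fix v S assume S: "S \<in> \<S>" "v \<in> permutations_of_set S"
        hence "distinct v" "set v = S" by (auto simp: permutations_of_set_def)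
        moreover from this have "length v = k" using S by (auto simp: \<S>_def ksubsets_def distinct_card)
        ultimately show "v \<in> G" using S cross_eq_edges_spanned[OF E, of v]
          by (auto simp: G_def lists_of_def \<S>_def ksubsets_def)
      qed
    qed
    finally have "card \<S> * fact k \<le> card G" .
    hence "real (card \<S>) * fact k \<le> card G" by (metis of_nat_fact of_nat_le_iff of_nat_mult)
    also have "\<dots> \<le> B * real n ^ k" unfolding G_def by (rule le[OF E])
    finally have *: "real (card \<S>) * fact k \<le> B * real n ^ k" .
    have nk: "0 < n choose k" using n by simp
    have "real (card \<S>) / (n choose k) = (real (card \<S>) * fact k) / (fact k * (n choose k))"
      by simp
    also have "\<dots> \<le> (B * real n ^ k) / (fact k * (n choose k))"
      by (rule divide_right_mono[OF *]) simp
    finally show "measure_pmf.prob (pmf_of_set (ksubsets {..<n} k)) {S. edges_spanned E S = l}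
        \<le> B * (real n ^ k / (fact k * (n choose k)))"
      using prob_eq[of k n E l] n by (simp add: \<S>_def)
  qed
  thus "\<exists>N. \<forall>n\<ge>N. max_ind n k l \<le> B * (real n ^ k / (fact k * (n choose k)))" by blast
qed

section \<open>Choice of parameters in the two regimes\<close>

text \<open>With few non-isolated positions the window \<open>x\<close> can be a constant fraction
  of \<open>k\<close>, so that a constant fraction of them is resampled and the largest weight is
  \<open>O(l^(-1/4))\<close>.\<close>

lemma (in adjacency) card_few_nonisolated_le:
  fixes s :: real and k l :: nat
  assumes V: "finite V" and s: "1600 \<le> s" "real k = s ^ 4" and l: "2 ^ 20 \<le> l"
  shows "card {v \<in> lists_of V k. cross v v = 2 * l \<and> card (nonisolated v) \<le> s ^ 3} \<le>
    real (card V) ^ k * (66 * real l powr (- 1 / 4) + 32 / s)"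
proof -
  \<comment> \<open>The divisor 16 makes \<open>4 x / k\<close> at most 1/4. As
    \<open>m1 = s^3\<close> and \<open>y \<le> s\<close>, the term \<open>m1 y x / k^2\<close> is at
    most 1/16. The general bound is used with 1/2 in place of \<open>\<epsilon>\<close>, hence
    \<open>T = y / 4\<close> up to rounding.\<close>
  define x where "x = k div 16"
  define y where "y = nat \<lfloor>s\<rfloor>"
  define T where "T = nat \<lfloor>real y / 4\<rfloor>"
  define r where "r = real l powr (1 / 4)"
  have r4: "r ^ 4 = real l" using l by (simp add: r_def powr_power)
  have r0: "0 < r" using l by (simp add: r_def)
  have r2: "r\<^sup>2 = sqrt (real l)"
    by (rule real_sqrt_unique[symmetric]) (use r4 in \<open>auto simp flip: power_mult\<close>)
  \<comment> \<open>The size of \<open>l\<close> serves to make the term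
    \<open>4 k / (x sqrt l)\<close> at most 68/1024.\<close>
  have r2_ge: "1024 \<le> r\<^sup>2" unfolding r2 using l by (intro real_le_rsqrt) simp
  have y: "real y \<le> s" "s / 2 \<le> real y" using s unfolding y_def by linarith+
  have T: "real T \<le> real y / 4" "s / 16 \<le> real T" using s y unfolding T_def by linarith+
  have s3: "s ^ 3 * 1600 \<le> s ^ 4" using s(1) by (simp add: power3_eq_cube power4_eq_xxxx mult.commute)
  have s1: "s * (1600 * (1600 * 1600)) \<le> s ^ 4"
  proof -
    have "1600 * (1600 * 1600) \<le> s * (s * s)" using s(1) by (intro mult_mono) auto
    hence "s * (1600 * (1600 * 1600)) \<le> s * (s * (s * s))" using s(1) by (intro mult_left_mono) auto
    thus ?thesis by (simp add: power4_eq_xxxx)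
  qed
  have kbig: "1600 * (1600 * (1600 * 1600)) \<le> real k" using s1 s by simp
  have x: "real x \<le> k / 16" "real k / 17 \<le> real x"
  proof -
    have "k = 16 * x + k mod 16" by (simp add: x_def)
    moreover have "k mod 16 < 16" by simp
    ultimately have "real k = 16 * real x + real (k mod 16)" "real (k mod 16) < 16" by linarith+
    thus "real x \<le> k / 16" "real k / 17 \<le> real x" using kbig by simp_all
  qed
  have x0: "0 < real x" using x kbig by simp
  have "real y \<le> real x" using y x s1 s by simp
  hence yx: "0 < y" "y \<le> x" "x \<le> k" using y s by (auto simp: x_def)
  define c where "c = 1 - 4 * k / (x * sqrt l) - 4 * x / k - 4 / (1/2 * x) - 4 / (1/2 * y) - s ^ 3 * y * x / k\<^sup>2"
  have c: "1/2 \<le> c"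
  proof -
    have kx: "k / x \<le> 17" using x(2) x0 by (simp add: field_simps)
    have "4 * k / (x * sqrt l) = 4 * (k / x) / r\<^sup>2" by (simp add: r2)
    also have "\<dots> \<le> 4 * 17 / 1024" using kx r2_ge by (intro frac_le mult_left_mono) auto
    finally have 1: "4 * k / (x * sqrt l) \<le> 68 / 1024" by simp
    have 2: "4 * x / k \<le> 1/4" using x kbig by (simp add: field_simps)
    have 3: "4 / (1/2 * x) \<le> 1 / 100" using x kbig x0 by (simp add: field_simps)
    have 4: "4 / (1/2 * y) \<le> 1 / 100" using y s by (simp add: field_simps)
    have "s ^ 3 * y * x \<le> s ^ 3 * s * (k / 16)" using y x s by (intro mult_mono) auto
    also have "\<dots> = k\<^sup>2 / 16" using s by (simp add: power2_eq_square power3_eq_cube power4_eq_xxxx)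
    finally have 5: "s ^ 3 * y * x / k\<^sup>2 \<le> 1 / 16" using kbig by (simp add: field_simps)
    show ?thesis using 1 2 3 4 5 unfolding c_def by argo
  qed
  define G where "G = {v \<in> lists_of V k. cross v v = 2 * l \<and> sqrt l \<le> card (nonisolated v) \<and> card (nonisolated v) \<le> s ^ 3}"
  have "c * card G \<le> real (card V) ^ k * (2 * sqrt (8 * k / (1/2 * x * sqrt l)) + 1 / T)"
    unfolding c_def G_def
  proof (rule card_lists_with_degree_sum_le[OF V yx])
    show "s ^ 3 \<le> (1 - 1/2) * real k" using s3 s by simp
    have "0 < T" using T s by (intro Nat.gr0I) auto
    thus "1 \<le> T" by simp
  qed (use T l in auto)
  also have "\<dots> \<le> real (card V) ^ k * (33 / r + 16 / s)"
  proof (intro mult_left_mono add_mono)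
    have "8 * k / (1/2 * x * sqrt l) = 16 * (k / x) / r\<^sup>2" by (simp add: r2)
    \<comment> \<open>Here \<open>16 * 17 = 272\<close> is just below \<open>(33/2)^2\<close>. The
      factor 2 of the bound and the division by \<open>c \<ge> 1/2\<close> turn 33/2 into
      66.\<close>
    also have "\<dots> \<le> (33/2)\<^sup>2 / r\<^sup>2"
    proof (intro divide_right_mono)
      have "k / x \<le> 17" using x(2) x0 by (simp add: field_simps)
      thus "16 * (k / x) \<le> (33/2)\<^sup>2" by (simp add: power2_eq_square)
    qed simp
    also have "\<dots> = ((33/2) / r)\<^sup>2" by (simp add: power_divide)
    finally have "sqrt (8 * k / (1/2 * x * sqrt l)) \<le> (33/2) / r"
      using r0 by (intro real_le_lsqrt) auto
    thus "2 * sqrt (8 * k / (1/2 * x * sqrt l)) \<le> 33 / r" by simp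
    have "1 / real T \<le> 1 / (s / 16)" using T s by (intro frac_le) auto
    thus "1 / real T \<le> 16 / s" by simp
  qed simp
  finally have "c * card G \<le> real (card V) ^ k * (33 / r + 16 / s)" .
  moreover have "1/2 * real (card G) \<le> c * card G" using c by (intro mult_right_mono) auto
  ultimately have "card G \<le> 2 * (real (card V) ^ k * (33 / r + 16 / s))" by linarith
  also have "\<dots> = real (card V) ^ k * (66 / r + 32 / s)" by (simp add: algebra_simps)
  finally have "card G \<le> real (card V) ^ k * (66 / r + 32 / s)" .
  moreover have "{v \<in> lists_of V k. cross v v = 2 * l \<and> card (nonisolated v) \<le> s ^ 3} \<subseteq> G"
  proof safe
    fix v assume v: "v \<in> lists_of V k" "cross v v = 2 * l" "card (nonisolated v) \<le> s ^ 3"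
    have "2 * l \<le> (card (nonisolated v))\<^sup>2" using cross_le_card_nonisolated[of v] v by simp
    hence "l \<le> (card (nonisolated v))\<^sup>2" by simp
    hence "real l \<le> (real (card (nonisolated v)))\<^sup>2" by (metis of_nat_le_iff of_nat_power)
    hence "sqrt l \<le> card (nonisolated v)" by (intro real_le_lsqrt) auto
    thus "v \<in> G" using v by (simp add: G_def)
  qed
  hence "card {v \<in> lists_of V k. cross v v = 2 * l \<and> card (nonisolated v) \<le> s ^ 3} \<le> card G"
    by (rule card_mono[rotated]) (simp add: G_def finite_lists_of V)
  moreover have "66 / r = 66 * real l powr (- 1 / 4)" by (simp add: r_def powr_minus_divide)
  ultimately show ?thesis by simp
qed

text \<open>With up to \<open>(1 - \<epsilon>) k\<close> non-isolated positions,
  \<open>m1 y x / k^2\<close> stays small only for a shorter window. For \<open>x\<close> near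
  \<open>s^3\<close> this window still receives about \<open>x s^3 / k\<close>, that is
  \<open>s^2\<close>, of them, so the largest weight is \<open>O(1/s)\<close> for fixed
  \<open>\<epsilon>\<close>.\<close>

lemma (in adjacency) card_many_nonisolated_le:
  fixes s \<epsilon> :: real and k l :: nat
  assumes V: "finite V" and s: "1600 \<le> s" "real k = s ^ 4"
    and \<epsilon>: "0 < \<epsilon>" "\<epsilon> \<le> 1/2" "640 \<le> \<epsilon> * s" and l: "2 * real l \<le> (1 - \<epsilon>) * k"
  shows "card {v \<in> lists_of V k. cross v v = 2 * l \<and> s ^ 3 \<le> card (nonisolated v)} \<le>
    real (card V) ^ k * (80 / (\<epsilon> * s))"
proof -
  define x where "x = nat \<lfloor>s ^ 3\<rfloor>"
  \<comment> \<open>The quarter makes \<open>m1 y x / k^2\<close> at most 1/4, since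
    \<open>s * s^3 = k\<close>.\<close>
  define y where "y = nat \<lfloor>s / 4\<rfloor>"
  define T where "T = nat \<lfloor>\<epsilon> * y / 2\<rfloor>"
  have s3: "s * (1600 * 1600) \<le> s ^ 3"
  proof -
    have "1600 * 1600 \<le> s * s" using s(1) by (intro mult_mono) auto
    hence "s * (1600 * 1600) \<le> s * (s * s)" using s(1) by (intro mult_left_mono) auto
    thus ?thesis by (simp add: power3_eq_cube)
  qed
  have s0: "0 < s" using s by simp
  have x: "real x \<le> s ^ 3" "s ^ 3 / 2 \<le> real x" using s s3 unfolding x_def by linarith+
  have y: "real y \<le> s / 4" "s / 8 \<le> real y" using s unfolding y_def by linarith+
  have "\<epsilon> * (s / 8) \<le> \<epsilon> * real y" using y \<epsilon> by (intro mult_left_mono) auto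
  hence ey: "\<epsilon> * s / 8 \<le> \<epsilon> * real y" by simp
  have T: "real T \<le> \<epsilon> * y / 2" "\<epsilon> * s / 32 \<le> real T" using ey \<epsilon>(3) unfolding T_def by linarith+
  have "real y \<le> real x" using x y s3 s by linarith
  moreover have "real x \<le> real k"
  proof -
    have "s ^ 3 * 1 \<le> s ^ 3 * s" using s by (intro mult_left_mono) auto
    also have "\<dots> = real k" by (simp add: s power3_eq_cube power4_eq_xxxx)
    finally show ?thesis using x by simp
  qed
  ultimately have yx: "0 < y" "y \<le> x" "x \<le> k" using y s by (auto intro: Nat.gr0I)
  have x0: "0 < real x" using yx by simp
  have k0: "0 < real k" using s by simp
  define c where "c = 1 - 4 * k / (x * s ^ 3) - 4 * x / k - 4 / (\<epsilon> * x) - 4 / (\<epsilon> * y) - ((1 - \<epsilon>) * k) * y * x / k\<^sup>2"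
  have kx: "k / (x * s ^ 3) \<le> 2 / s\<^sup>2"
  proof -
    have "k / (x * s ^ 3) \<le> k / (s ^ 3 / 2 * s ^ 3)"
      using x s0 x0 by (intro divide_left_mono mult_right_mono) auto
    also have "\<dots> = 2 / s\<^sup>2" unfolding s(2) using s0 by (simp add: field_simps flip: power_add)
    finally show ?thesis .
  qed
  have c: "1/2 \<le> c"
  proof -
    have "1600 * 1600 \<le> s\<^sup>2" unfolding power2_eq_square using s by (intro mult_mono) auto
    hence "2 / s\<^sup>2 \<le> 1 / 1000" using s0 by (simp add: field_simps)
    hence 1: "4 * k / (x * s ^ 3) \<le> 4 / 1000" using kx by simp
    have "4 * real x \<le> 4 * s ^ 3" using x by simp
    also have "\<dots> \<le> s ^ 3 * s / 400" using s mult_left_mono[of 1600 s "s ^ 3"] by simp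
    finally have 2: "4 * x / k \<le> 1/400" unfolding s(2) using s0 by (simp add: field_simps power3_eq_cube power4_eq_xxxx)
    have "\<epsilon> * real y \<le> \<epsilon> * real x" using \<epsilon> yx by simp
    hence e: "80 \<le> \<epsilon> * real y" "80 \<le> \<epsilon> * real x" using ey \<epsilon> by linarith+
    have 3: "4 / (\<epsilon> * x) \<le> 4 / 80" "4 / (\<epsilon> * y) \<le> 4 / 80" using e by (intro frac_le; simp)+
    have "(1 - \<epsilon>) * k \<le> 1 * real k" using \<epsilon> by (intro mult_right_mono) auto
    hence "((1 - \<epsilon>) * k) * y * x \<le> (1 * k) * (s / 4) * s ^ 3"
      using y x \<epsilon> s0 by (intro mult_mono) auto
    also have "\<dots> = k\<^sup>2 / 4" by (simp add: s(2) power2_eq_square power3_eq_cube power4_eq_xxxx)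
    finally have 4: "((1 - \<epsilon>) * k) * y * x / k\<^sup>2 \<le> 1 / 4" using k0 by (simp add: field_simps)
    show ?thesis using 1 2 3 4 unfolding c_def by linarith
  qed
  define G where "G = {v \<in> lists_of V k. cross v v = 2 * l \<and> s ^ 3 \<le> card (nonisolated v) \<and> card (nonisolated v) \<le> (1 - \<epsilon>) * k}"
  have T0: "0 < real T" using T \<epsilon> by linarith
  have "c * card G \<le> real (card V) ^ k * (2 * sqrt (8 * k / (\<epsilon> * x * s ^ 3)) + 1 / T)"
    unfolding c_def G_def
    by (rule card_lists_with_degree_sum_le[OF V yx]) (use T T0 s0 \<epsilon> in auto)
  also have "\<dots> \<le> real (card V) ^ k * (8 / (\<epsilon> * s) + 32 / (\<epsilon> * s))"
  proof (intro mult_left_mono add_mono)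
    have "8 * k / (\<epsilon> * x * s ^ 3) = 8 / \<epsilon> * (k / (x * s ^ 3))" by simp
    also have "\<dots> \<le> 8 / \<epsilon> * (2 / s\<^sup>2)" using \<epsilon> by (intro mult_left_mono kx) auto
    also have "\<dots> = 16 / (\<epsilon> * s\<^sup>2)" by simp
    \<comment> \<open>Giving up a factor \<open>\<epsilon>\<close> makes this a square and matches
      the \<open>1 / (\<epsilon> s)\<close> coming from \<open>1/T\<close>.\<close>
    also have "\<dots> \<le> 16 / (\<epsilon>\<^sup>2 * s\<^sup>2)"
      using \<epsilon> s0 by (intro divide_left_mono mult_right_mono) (auto simp: power2_eq_square)
    also have "\<dots> = (4 / (\<epsilon> * s))\<^sup>2" by (simp add: power_divide power_mult_distrib)
    finally have "sqrt (8 * k / (\<epsilon> * x * s ^ 3)) \<le> 4 / (\<epsilon> * s)"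
      using \<epsilon> s0 by (intro real_le_lsqrt) auto
    thus "2 * sqrt (8 * k / (\<epsilon> * x * s ^ 3)) \<le> 8 / (\<epsilon> * s)" by simp
    have "1 / real T \<le> 1 / (\<epsilon> * s / 32)" using T \<epsilon> by (intro frac_le) auto
    thus "1 / real T \<le> 32 / (\<epsilon> * s)" by simp
  qed simp
  also have "\<dots> = real (card V) ^ k * (40 / (\<epsilon> * s))" by simp
  finally have "c * card G \<le> real (card V) ^ k * (40 / (\<epsilon> * s))" .
  moreover have "1/2 * real (card G) \<le> c * card G" using c by (intro mult_right_mono) auto
  ultimately have "card G \<le> 2 * (real (card V) ^ k * (40 / (\<epsilon> * s)))" by linarith
  also have "\<dots> = real (card V) ^ k * (80 / (\<epsilon> * s))" by simp
  finally have "card G \<le> real (card V) ^ k * (80 / (\<epsilon> * s))" .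
  moreover have "{v \<in> lists_of V k. cross v v = 2 * l \<and> s ^ 3 \<le> card (nonisolated v)} \<subseteq> G"
  proof safe
    fix v assume v: "v \<in> lists_of V k" "cross v v = 2 * l" "s ^ 3 \<le> card (nonisolated v)"
    \<comment> \<open>This is where the upper bound on \<open>l\<close> enters: it leaves at least
      \<open>\<epsilon> k\<close> isolated positions.\<close>
    have "real (card (nonisolated v)) \<le> 2 * real l" using card_nonisolated_le[of v] v by linarith
    thus "v \<in> G" using v l by (simp add: G_def)
  qed
  hence "card {v \<in> lists_of V k. cross v v = 2 * l \<and> s ^ 3 \<le> card (nonisolated v)} \<le> card G"
    by (rule card_mono[rotated]) (simp add: G_def finite_lists_of V)
  ultimately show ?thesis by simp
qed

text \<open>The two regimes meet at \<open>s^3\<close> non-isolated positions; the errors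
  \<open>32 / s\<close> and \<open>80 / (\<epsilon> s)\<close> are merged using
  \<open>\<epsilon> \<le> 1\<close>.\<close>

lemma ind_upper_bound:
  fixes s \<epsilon> :: real and k l :: nat
  assumes s: "1600 \<le> s" "real k = s ^ 4" and \<epsilon>: "0 < \<epsilon>" "\<epsilon> \<le> 1/2" "640 \<le> \<epsilon> * s"
    and l: "2 ^ 20 \<le> l" "2 * real l \<le> (1 - \<epsilon>) * k"
  shows "ind k l \<le> 66 * real l powr (- 1 / 4) + 112 / (\<epsilon> * s)"
proof (rule ind_leI)
  have es: "0 < \<epsilon> * s" using \<epsilon> by linarith
  fix n :: nat and E assume E: "E \<in> graphs_on {..<n}"
  interpret adjacency "\<lambda>x y. {x, y} \<in> E" using E by (rule adjacency_graphs_on)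
  let ?few = "{v \<in> lists_of {..<n} k. cross v v = 2 * l \<and> card (nonisolated v) \<le> s ^ 3}"
  let ?many = "{v \<in> lists_of {..<n} k. cross v v = 2 * l \<and> s ^ 3 \<le> card (nonisolated v)}"
  have "card {v \<in> lists_of {..<n} k. cross v v = 2 * l} \<le> card (?few \<union> ?many)"
    by (rule card_mono) (auto simp: finite_lists_of)
  also have "\<dots> \<le> card ?few + card ?many" by (rule card_Un_le)
  finally have "real (card {v \<in> lists_of {..<n} k. cross v v = 2 * l}) \<le> real (card ?few) + card ?many" by linarith
  also have "\<dots> \<le> real n ^ k * (66 * real l powr (- 1 / 4) + 32 / s) + real n ^ k * (80 / (\<epsilon> * s))"
    using card_few_nonisolated_le[of "{..<n}" s k l] card_many_nonisolated_le[of "{..<n}" s k \<epsilon> l] s \<epsilon> l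
    by (intro add_mono) auto
  also have "\<dots> = (66 * real l powr (- 1 / 4) + (32 / s + 80 / (\<epsilon> * s))) * real n ^ k"
    by (simp add: algebra_simps)
  also have "\<dots> \<le> (66 * real l powr (- 1 / 4) + 112 / (\<epsilon> * s)) * real n ^ k"
  proof (intro mult_right_mono add_left_mono)
    have "32 / s \<le> 32 / (\<epsilon> * s)" using \<epsilon> s es by (intro divide_left_mono) auto
    thus "32 / s + 80 / (\<epsilon> * s) \<le> 112 / (\<epsilon> * s)" by (simp add: field_simps)
  qed simp
  finally show "card {v \<in> lists_of {..<n} k. cross v v = 2 * l} \<le> (66 * real l powr (- 1 / 4) + 112 / (\<epsilon> * s)) * real n ^ k" .
qed

theorem theorem1p3:
  fixes \<epsilon> :: real
  assumes "\<epsilon> > 0"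
  shows "\<forall>\<^sub>F k :: nat in sequentially.
    (\<forall>l :: nat. 1 \<le> l \<and> real l \<le> real k / (log 2 (real k)) ^ 4 \<longrightarrow>
       ind k l \<le> 90 * real l powr (- 1 / 4)) \<and>
    (\<forall>l :: nat. real k / (log 2 (real k)) ^ 4 \<le> real l \<and> real l \<le> (1 - \<epsilon>) * real k / 2 \<longrightarrow>
       ind k l \<le> 90 * real k powr (- 1 / 4) * log 2 (real k))"
proof -
  \<comment> \<open>A smaller \<open>\<epsilon>\<close> only enlarges the second range of
    \<open>l\<close>, so it may be capped at 1/2.\<close>
  define \<delta> where "\<delta> = min \<epsilon> (1/2)"
  have \<delta>: "0 < \<delta>" "\<delta> \<le> 1/2" "\<delta> \<le> \<epsilon>" using assms by (auto simp: \<delta>_def)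
  have ev1: "\<forall>\<^sub>F k :: nat in sequentially. max 1600 (640 / \<delta>) \<le> real k powr (1/4)"
    by (rule filterlim_at_top[THEN iffD1, rule_format]) real_asymp
  have ev2: "\<forall>\<^sub>F k :: nat in sequentially. max 2 (5 / \<delta>) \<le> log 2 (real k)"
    by (rule filterlim_at_top[THEN iffD1, rule_format]) real_asymp
  have ev3: "\<forall>\<^sub>F k :: nat in sequentially. 2 ^ 20 \<le> real k / (log 2 (real k)) ^ 4"
    by (rule filterlim_at_top[THEN iffD1, rule_format]) real_asymp
  show ?thesis using ev1 ev2 ev3
  proof eventually_elim
    case (elim k)
    define s where "s = real k powr (1/4)"
    define b where "b = log 2 (real k)"
    have s: "1600 \<le> s" "640 / \<delta> \<le> s" using elim(1) by (auto simp: s_def)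
    have b: "2 \<le> b" "5 / \<delta> \<le> b" using elim(2) by (auto simp: b_def)
    have k0: "0 < real k" using s by (intro of_nat_0_less_iff[THEN iffD2] Nat.gr0I) (auto simp: s_def)
    have s4: "real k = s ^ 4" using k0 by (simp add: s_def powr_power)
    have s640: "640 \<le> \<delta> * s" using s(2) \<delta> by (simp add: field_simps)
    have k_powr: "real k powr (- 1 / 4) = 1 / s" using k0 by (simp add: s_def powr_minus_divide)
    \<comment> \<open>The two ranges of \<open>l\<close> meet where \<open>l^(-1/4) = b / s\<close>.
      Below that point \<open>b / s\<close> is absorbed into \<open>l^(-1/4)\<close>, above it the
      reverse, with total constant \<open>66 + 24 = 90\<close>.\<close>
    have kb: "(real k / b ^ 4) powr (- 1 / 4) = b / s"
    proof -
      have "real k / b ^ 4 = (s / b) powr 4" using s b by (simp add: s4 power_divide powr_realpow)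
      hence "(real k / b ^ 4) powr (- 1 / 4) = (s / b) powr (4 * (- 1 / 4))"
        by (simp only: powr_powr)
      also have "\<dots> = b / s" using s b by (simp add: powr_minus_divide)
      finally show ?thesis .
    qed
    \<comment> \<open>The bound \<open>b \<ge> 5 / \<delta>\<close> gives
      \<open>24 \<delta> b \<ge> 120\<close>; the logarithm absorbs the dependence on
      \<open>\<delta>\<close>.\<close>
    have err: "112 / (\<delta> * s) \<le> 24 * (b / s)"
    proof -
      have "112 \<le> 24 * (\<delta> * b)" using b(2) \<delta> by (simp add: field_simps)
      thus ?thesis using \<delta> s by (simp add: field_simps)
    qed
    have main: "ind k l \<le> 66 * real l powr (- 1 / 4) + 24 * (b / s)"
      if "2 ^ 20 \<le> l" "2 * real l \<le> (1 - \<delta>) * k" for l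
      using ind_upper_bound[OF s(1) s4 \<delta>(1,2) s640 that] err by linarith
    show ?case
    proof (intro conjI allI impI)
      fix l :: nat assume l: "1 \<le> l \<and> real l \<le> real k / (log 2 (real k)) ^ 4"
      show "ind k l \<le> 90 * real l powr (- 1 / 4)"
      proof (cases "2 ^ 20 \<le> l")
        case True
        have "b / s \<le> real l powr (- 1 / 4)"
          unfolding kb[symmetric] by (rule powr_mono2') (use l in \<open>auto simp: b_def\<close>)
        moreover have "2 * real l \<le> (1 - \<delta>) * k"
        proof -
          have "2 ^ 4 \<le> b ^ 4" using b(1) by (intro power_mono) auto
          hence "real k / b ^ 4 \<le> real k / 16" using b k0 by (intro divide_left_mono) auto
          moreover have "real l \<le> real k / b ^ 4" using l by (simp add: b_def)
          ultimately have "2 * real l \<le> 1/2 * k" using k0 by linarith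
          also have "\<dots> \<le> (1 - \<delta>) * k" using \<delta> by (intro mult_right_mono) auto
          finally show ?thesis .
        qed
        ultimately show ?thesis using main[OF True] by linarith
      next
        case False
        \<comment> \<open>For \<open>l\<close> below \<open>2^20\<close> the right-hand side is at
          least \<open>90 / 32\<close>, so the trivial bound 1 is enough.\<close>
        have "(2 :: real) ^ 20 = 2 powr 20" by (rule powr_numeral[symmetric]) simp
        hence "((2 :: real) ^ 20) powr (- 1 / 4) = 2 powr (20 * (- 1 / 4))" by (simp only: powr_powr)
        also have "\<dots> = 2 powr (- 5)" by simp
        also have "\<dots> = 1 / 32" by (simp add: powr_minus_divide)
        finally have "1 / 32 = ((2 :: real) ^ 20) powr (- 1 / 4)" ..
        also have "\<dots> \<le> real l powr (- 1 / 4)"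
          by (rule powr_mono2') (use l False in auto)
        finally show ?thesis using ind_le_1[of k l] by linarith
      qed
    next
      fix l :: nat assume l: "real k / (log 2 (real k)) ^ 4 \<le> real l \<and> real l \<le> (1 - \<epsilon>) * real k / 2"
      have "real l \<ge> 2 ^ 20" using elim(3) l by linarith
      hence l20: "2 ^ 20 \<le> l" by simp
      have "(1 - \<epsilon>) * real k \<le> (1 - \<delta>) * k" using \<delta> by (intro mult_right_mono) auto
      hence l2: "2 * real l \<le> (1 - \<delta>) * k" using l by linarith
      have "real l powr (- 1 / 4) \<le> b / s"
        unfolding kb[symmetric] by (rule powr_mono2') (use l k0 b in \<open>auto simp: b_def\<close>)
      hence "ind k l \<le> 90 * (b / s)" using main[OF l20 l2] by linarith
      thus "ind k l \<le> 90 * real k powr (- 1 / 4) * log 2 (real k)"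
        unfolding k_powr by (simp add: b_def)
    qed
  qed
qed

end
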